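(* Let $e$ be an even positive integer, $q=2^e$, $d=(q^2+q+1)/3$, and $\sigma(X)=X+X^d+X^{dq}\in\mathbb{F}_{q^2}[X]$ (a permutation polynomial of $\mathbb{F}_{q^2}$). For $\alpha\in\mathbb{F}_q^*$ let $f_\alpha(x)=\operatorname{Tr}_{q^2}\bigl(\alpha(\sigma^{-1}(x))^3\bigr)$ for $x\in\mathbb{F}_{q^2}$. Then: (a) if $\alpha$ is a cube in $\mathbb{F}_q$, then $\{W_{f_\alpha}(\beta):\beta\in\mathbb{F}_{q^2}\setminus\mathbb{F}_q\}$ equals $\{0\}$ when $e=2$ and equals $\{-2q,0,2q\}$ when $e\ge 4$; (b) if $\alpha$ is not a cube in $\mathbb{F}_q$, then $\{W_{f_\alpha}(\beta):\beta\in\mathbb{F}_{q^2}\setminus\mathbb{F}_q\}=\{q,-q\}$.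
   Context: $\operatorname{Tr}_q$ and $\operatorname{Tr}_{q^2}$ denote the absolute traces from $\mathbb{F}_q$ and $\mathbb{F}_{q^2}$ to $\mathbb{F}_2$; $\sigma^{-1}$ is the compositional inverse of the permutation of $\mathbb{F}_{q^2}$ induced by $\sigma$. For a Boolean function $f$ on $\mathbb{F}_{q^2}$, its Walsh transform is $W_f(\beta)=\sum_{x\in\mathbb{F}_{q^2}}(-1)^{f(x)+\operatorname{Tr}_{q^2}(\beta x)}$ for $\beta\in\mathbb{F}_{q^2}$. *)

theory Defs
  imports
    "HOL-Computational_Algebra.Polynomial"
    "HOL-Library.Z2"
begin

text \<open>The finite field with \<open>q\<^sup>2\<close> elements is a type of class \<open>finite_field\<close> with \<open>q\<^sup>2\<close>
  elements, and the field with \<open>q\<close> elements is a subfield \<open>K\<close> of it with \<open>card K = q\<close>.\<close>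

definition is_subfield :: "'a::field set \<Rightarrow> bool" where
  "is_subfield K \<longleftrightarrow> 0 \<in> K \<and> 1 \<in> K \<and>
     (\<forall>x\<in>K. \<forall>y\<in>K. x - y \<in> K \<and> x * y \<in> K) \<and> (\<forall>x\<in>K. inverse x \<in> K)"

text \<open>For a field with \<open>2 ^ n\<close> elements the sum \<open>x + x\<^sup>2 + x\<^sup>4 + \<dots> + x ^ 2 ^ (n - 1)\<close> lies in the
  prime field \<open>{0, 1}\<close> (lemma \<open>abs_trace_in_prime_field\<close> below). It is read as an element of the
  two-element field \<open>bit\<close>.\<close>

definition abs_trace :: "nat \<Rightarrow> 'a::finite_field \<Rightarrow> bit" where
  "abs_trace n x = of_bool ((\<Sum>i<n. x ^ (2 ^ i)) = 1)"

lemma abs_trace_in_prime_field: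
  fixes x :: "'a::finite_field"
  assumes card: "card (UNIV :: 'a set) = 2 ^ n"
  shows "(\<Sum>i<n. x ^ (2 ^ i)) \<in> {0, 1}"
proof -
  let ?t = "\<Sum>i<n. x ^ (2 ^ i)"
  have "n \<noteq> 0"
  proof
    assume "n = 0"
    then obtain z where "(UNIV :: 'a set) = {z}" using card by (auto simp: card_1_singleton_iff)
    then have "(0::'a) = 1" by (metis UNIV_I singletonD)
    then show False by simp
  qed
  then have "(- 1 :: 'a) = 1"
    using finite_field_power_card_eq_same[of "- 1 :: 'a"] by (simp add: card)
  then have two: "(2::'a) = 0" by (metis add.right_inverse one_add_one)
  have sq: "(a + b) ^ 2 = a ^ 2 + b ^ 2" for a b :: 'a
    by (simp add: power2_sum two)
  have "(\<Sum>i<m. x ^ (2 ^ i)) ^ 2 = (\<Sum>i<m. x ^ (2 ^ Suc i))" for m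
    by (induction m) (simp_all add: sq power_mult mult.commute flip: power_mult)
  then have "?t ^ 2 = (\<Sum>i<n. x ^ (2 ^ Suc i))" .
  also have "\<dots> + x = (\<Sum>i<Suc n. x ^ (2 ^ i))"
    by (subst sum.lessThan_Suc_shift) simp
  also have "\<dots> = ?t + x"
    using finite_field_power_card_eq_same[of x] by (simp add: card)
  finally have "?t ^ 2 = ?t" by simp
  then have "?t * (?t - 1) = 0" by (simp add: power2_eq_square algebra_simps)
  then show ?thesis by auto
qed

text \<open>Walsh transform of a Boolean function on a field with \<open>2 ^ n\<close> elements. The sign is
  \<open>(-1) ^ b\<close> for \<open>b\<close> in the two-element field, with \<open>b\<close> lifted to an exponent in \<open>{0, 1}\<close>.\<close>

definition walsh :: "nat \<Rightarrow> ('a::finite_field \<Rightarrow> bit) \<Rightarrow> 'a \<Rightarrow> int" where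
  "walsh n f \<beta> = (\<Sum>x\<in>UNIV. (-1) ^ of_bool (f x + abs_trace n (\<beta> * x) = 1))"

text \<open>The division by 3 is exact for \<open>q = 2 ^ e\<close> with \<open>e\<close> even, as then \<open>q mod 3 = 1\<close>.\<close>

definition sigma :: "nat \<Rightarrow> 'a::field poly" where
  "sigma q = (let d = (q\<^sup>2 + q + 1) div 3 in monom 1 1 + monom 1 d + monom 1 (d * q))"

text \<open>\<open>2 * e\<close> is the degree over the prime field of the field with \<open>(2 ^ e)\<^sup>2\<close> elements.\<close>

definition f_alpha :: "nat \<Rightarrow> 'a::finite_field \<Rightarrow> 'a \<Rightarrow> bit" where
  "f_alpha e \<alpha> x = abs_trace (2 * e) (\<alpha> * (inv (poly (sigma (2 ^ e))) x) ^ 3)"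

end

theory Submission
  imports Defs "HOL-Analysis.Determinants"
begin

text \<open>
  Write \<open>F\<close> for the field with \<open>q\<^sup>2\<close> elements and \<open>\<chi>(x) = \<plusminus>1\<close> for the sign given by the trace of \<open>x\<close>.
  On \<open>x = c y\<^sup>3\<close> with \<open>c \<in> K\<close> the trinomial is \<open>\<sigma>(x) = c y N(y)\<close> with \<open>N(y) = y\<^sup>2 + y y\<^sup>q + y\<^sup>2\<^sup>q\<close>, so
  \<open>s \<mapsto> s\<^sup>3 / N(s)\<close> inverts it. Letting \<open>c\<close> run through representatives of the cube classes and
  substituting \<open>y = \<omega>\<^sup>2 u + u\<^sup>q\<close> with \<open>\<omega>\<close> a primitive cube root of unity, three times a Walsh value
  becomes the sum over \<open>c\<close> of \<open>\<Sum>u. \<chi>(\<alpha> c\<^sup>3 u \<psi>\<^sup>3(u) + c b u \<psi>(u))\<close>, where \<open>\<psi>(u) = u\<^sup>2\<^sup>q\<close> and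
  \<open>\<psi>\<^sup>2(u) = u\<^sup>4\<close>; these are the quadratic forms of a Kasami function. They are invariant under
  \<open>u \<mapsto> \<omega> u\<close>, so each sum is \<open>q (-2)\<^sup>k\<close> with \<open>4\<^sup>k \<le> 64\<close> the number of elements of the radical.

  The radical equation is semilinear of degree 3 for \<open>u \<mapsto> u\<^sup>4\<close>. Iterating its companion matrix \<open>e\<close>
  times gives a 3 by 3 matrix \<open>T\<close> such that the radical for \<open>c\<close> is nontrivial iff \<open>P(z) = 0\<close> for
  \<open>P(z) = det (T + z)\<close> and \<open>z\<close> the cubic character of \<open>c\<close>. As \<open>T\<close> is unitary for a Hermitian form over
  the field with four elements, \<open>P(z)\<close> is \<open>0\<close> or \<open>1 / det T\<close> at the three cube roots of unity, and
  these values sum to \<open>1 + det T\<close>, where \<open>det T\<close> is the inverse of the cubic character of \<open>\<alpha>\<close>. Hence an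
  even number of the radicals is trivial if \<open>\<alpha>\<close> is a cube and an odd number if not. This restricts the
  Walsh values to \<open>0, \<plusminus>2q\<close>, respectively to odd multiples of \<open>q\<close>, and the first two moments of the
  Walsh transform over \<open>F\<close> and over \<open>K\<close> decide which of them occur outside \<open>K\<close>.
\<close>

section \<open>Fields of characteristic two and the additive character\<close>

locale quadratic_extension =
  fixes K :: "'a::finite_field set" and e q :: nat
  assumes even_e: "even e" and e_pos: "e > 0" and q_eq: "q = 2 ^ e"
    and card_F: "card (UNIV :: 'a set) = q\<^sup>2"
    and subfield_K: "is_subfield K" and card_K: "card K = q"
begin

lemma q_ge_4: "q \<ge> 4"
proof -
  have "e \<ge> 2" using even_e e_pos by presburger
  then have "(2::nat) ^ 2 \<le> 2 ^ e" by (rule power_increasing) simp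
  then show ?thesis by (simp add: q_eq)
qed

lemma q_sq_eq: "q\<^sup>2 = 2 ^ (2 * e)" "q\<^sup>2 = 4 ^ e"
proof -
  show "q\<^sup>2 = 2 ^ (2 * e)"
    by (simp add: q_eq mult.commute flip: power_mult)
  then show "q\<^sup>2 = 4 ^ e"
    by (simp add: power_mult)
qed

lemma two_eq_0: "(2::'a) = 0"
proof -
  have "(- 1 :: 'a) ^ q\<^sup>2 = - 1"
    using finite_field_power_card_eq_same[of "- 1 :: 'a"] by (simp add: card_F)
  moreover have "even (q\<^sup>2)" using e_pos by (simp add: q_eq)
  ultimately have "(1::'a) = - 1" by simp
  then show ?thesis by (metis add.right_inverse one_add_one)
qed

lemma add_self [simp]: "x + x = (0::'a)"
  using two_eq_0 by (metis mult_2 mult_zero_left)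

lemma add_self_left [simp]: "x + (x + y) = (y::'a)"
  by (metis add_self add.assoc add_0)

lemma uminus_eq [simp]: "- x = (x::'a)"
  using add_self[of x] by (metis minus_unique)

lemma diff_eq_add: "x - y = x + (y::'a)"
  using uminus_eq[of y] by (metis diff_conv_add_uminus)

lemma add_eq_0_iff_eq: "x + y = 0 \<longleftrightarrow> x = (y::'a)"
  by (metis add_self add_self_left add.right_neutral)

lemma char2_numeral: "numeral (Num.Bit0 k) = (0::'a)" "numeral (Num.Bit1 k) = (1::'a)"
proof -
  show *: "numeral (Num.Bit0 k) = (0::'a)" for k
    by (simp only: numeral_Bit0 add_self)
  show "numeral (Num.Bit1 k) = (1::'a)"
    using *[of k] by (simp only: numeral_Bit1) (simp only: numeral_Bit0 add_0)
qed

lemma power_two_add: "(x + y) ^ 2 ^ i = x ^ 2 ^ i + (y::'a) ^ 2 ^ i"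
proof (induction i)
  case (Suc i)
  have "(x + y) ^ 2 ^ Suc i = ((x + y) ^ 2 ^ i)\<^sup>2"
    by (simp add: mult.commute flip: power_mult)
  also have "\<dots> = (x ^ 2 ^ i)\<^sup>2 + (y ^ 2 ^ i)\<^sup>2"
    by (simp add: Suc power2_sum two_eq_0)
  finally show ?case by (simp add: mult.commute flip: power_mult)
qed simp

lemma power_add_char2:
  fixes x y :: 'a
  shows "(x + y)\<^sup>2 = x\<^sup>2 + y\<^sup>2" "(x + y) ^ 4 = x ^ 4 + y ^ 4"
    "(x + y) ^ 8 = x ^ 8 + y ^ 8" "(x + y) ^ 16 = x ^ 16 + y ^ 16"
    "(x + y) ^ 64 = x ^ 64 + y ^ 64" "(x + y) ^ q = x ^ q + y ^ q"
  using power_two_add[of x y 1] power_two_add[of x y 2] power_two_add[of x y 3]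
    power_two_add[of x y 4] power_two_add[of x y 6] power_two_add[of x y e]
  by (simp_all add: q_eq)

lemma power_q_sq: "x ^ q\<^sup>2 = (x::'a)"
  using finite_field_power_card_eq_same[of x] by (simp add: card_F)

lemma power_q_q [simp]: "(x ^ q) ^ q = (x::'a)"
  using power_q_sq[of x] by (simp add: power2_eq_square flip: power_mult)

lemma power_order_eq_1:
  assumes "x \<noteq> (0::'a)"
  shows "x ^ (q\<^sup>2 - 1) = 1"
proof -
  have "x * x ^ (q\<^sup>2 - 1) = x ^ Suc (q\<^sup>2 - 1)" by simp
  also have "\<dots> = x" using q_ge_4 power_q_sq[of x] by simp
  finally show ?thesis using assms by simp
qed

section \<open>The subfield as the fixed field of the \<open>q\<close>-th power map\<close>

lemma K_closed:
  shows "0 \<in> K" "1 \<in> K"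
    and "x \<in> K \<Longrightarrow> y \<in> K \<Longrightarrow> x + y \<in> K" "x \<in> K \<Longrightarrow> y \<in> K \<Longrightarrow> x * y \<in> K"
    and "x \<in> K \<Longrightarrow> inverse x \<in> K"
  using subfield_K diff_eq_add unfolding is_subfield_def by metis+

lemma K_power: "x \<in> K \<Longrightarrow> x ^ n \<in> K"
  by (induction n) (auto intro: K_closed)

text \<open>Multiplication by a nonzero \<open>x\<close> in \<open>K\<close> permutes
  \<open>K - {0}\<close>, so \<open>x ^ (q - 1) = 1\<close>. The polynomial X^q - X has at most
  \<open>q\<close> roots, hence \<open>K\<close> is its whole root set.\<close>

lemma K_iff: "x \<in> K \<longleftrightarrow> x ^ q = x"
proof -
  have fin: "finite K" by simp
  have *: "x ^ q = x" if x: "x \<in> K" for x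
  proof (cases "x = 0")
    case True
    then show ?thesis using q_ge_4 by simp
  next
    case False
    have "(\<Prod>y\<in>K-{0}. x * y) = x ^ (q - 1) * \<Prod>(K-{0})"
      using fin K_closed(1) by (simp add: prod.distrib card_K)
    also have "(\<Prod>y\<in>K-{0}. x * y) = \<Prod>(K-{0})"
      by (rule prod.reindex_bij_witness[of _ "\<lambda>y. inverse x * y" "\<lambda>y. x * y"])
        (use False x K_closed in auto)
    finally have "x ^ (q - 1) = 1" using fin by simp
    then have "x * x ^ (q - 1) = x" by simp
    then show ?thesis using q_ge_4 by (simp flip: power_Suc)
  qed
  let ?p = "monom 1 q + [:0, -1:] :: 'a poly"
  have deg: "degree ?p = q"
    using q_ge_4 by (subst degree_add_eq_left) (auto simp: degree_monom_eq)
  have p0: "?p \<noteq> 0" using deg q_ge_4 by (metis degree_0 not_numeral_le_zero)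
  have roots: "{x. poly ?p x = 0} = {x. x ^ q = x}"
    by (auto simp: poly_monom add_eq_0_iff_eq)
  have "card {x::'a. x ^ q = x} \<le> card K"
    using card_poly_roots_bound[OF p0] unfolding roots deg card_K .
  moreover have "K \<subseteq> {x. x ^ q = x}" using * by auto
  ultimately have "K = {x. x ^ q = x}"
    by (intro card_seteq) auto
  then show ?thesis by auto
qed

text \<open>On nonzero elements \<open>x ^ cubord\<close> is the cubic character: a cube root of
  unity that equals 1 exactly on the cubes.\<close>

definition cubord :: nat where "cubord = (q\<^sup>2 - 1) div 3"

lemma q_mod_3: "q mod 3 = 1"
proof -
  obtain k where "e = 2 * k" using even_e by auto
  then have "q = 4 ^ k" by (simp add: q_eq power_mult)
  moreover have "(4::nat) ^ k mod 3 = 1"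
  proof (induction k)
    case (Suc k)
    have "(4::nat) ^ Suc k mod 3 = (4 * (4 ^ k mod 3)) mod 3" by (simp add: mod_mult_right_eq)
    then show ?case by (simp add: Suc)
  qed simp
  ultimately show ?thesis by simp
qed

lemma q_eq_3: obtains l where "q = 3 * l + 1" "l > 0"
proof -
  have "q = 3 * (q div 3) + 1" using q_mod_3 by presburger
  then show thesis using that[of "q div 3"] q_ge_4 by linarith
qed

lemma cubord: "3 * cubord = q\<^sup>2 - 1" "cubord > 0"
proof -
  obtain l where l: "q = 3 * l + 1" "l > 0" by (rule q_eq_3)
  have *: "q\<^sup>2 - 1 = 3 * (l * (3 * l + 2))"
    unfolding l(1) by (simp add: power2_eq_square algebra_simps)
  show "3 * cubord = q\<^sup>2 - 1" "cubord > 0"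
    unfolding cubord_def * using l(2) by simp_all
qed

text \<open>The absolute trace with values in \<open>{0, 1} \<subseteq> 'a\<close> instead of \<open>bit\<close>.\<close>

definition tr :: "'a \<Rightarrow> 'a" where "tr x = (\<Sum>i<2*e. x ^ 2 ^ i)"

definition chi :: "'a \<Rightarrow> int" where "chi x = (if tr x = 1 then - 1 else 1)"

lemma tr_cases: "tr x = 0 \<or> tr x = 1"
  using abs_trace_in_prime_field[of "2 * e" x] by (auto simp: tr_def card_F q_sq_eq)

lemma tr_add: "tr (x + y) = tr x + tr y"
  by (simp add: tr_def power_two_add sum.distrib)

lemma chi_0 [simp]: "chi 0 = 1"
  by (simp add: chi_def tr_def power_0_left)

lemma chi_add: "chi (x + y) = chi x * chi y"
  using tr_cases[of x] tr_cases[of y] by (auto simp: chi_def tr_add)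

lemma chi_sq [simp]: "chi x * chi x = 1"
  by (simp add: chi_def)

lemma chi_cases: "chi x = 1 \<or> chi x = - 1"
  by (simp add: chi_def)

lemma tr_sq: "tr (x\<^sup>2) = tr x"
proof -
  have "(\<Sum>i<2*e. x ^ 2 ^ Suc i) + x = (\<Sum>i<Suc (2*e). x ^ 2 ^ i)"
    by (subst sum.lessThan_Suc_shift) simp
  also have "\<dots> = tr x + x"
    using power_q_sq[of x] by (simp add: tr_def q_sq_eq)
  finally have "(\<Sum>i<2*e. x ^ 2 ^ Suc i) = tr x" by simp
  then show ?thesis by (simp add: tr_def power_mult flip: power_mult)
qed

lemma chi_sq_arg: "chi (x\<^sup>2) = chi x"
  by (simp add: chi_def tr_sq)

lemma chi_power2: "chi (x ^ 2 ^ i) = chi x"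
proof (induction i)
  case (Suc i)
  have "x ^ 2 ^ Suc i = (x ^ 2 ^ i)\<^sup>2" by (simp add: mult.commute flip: power_mult)
  then show ?case by (simp only: chi_sq_arg Suc)
qed simp

lemma chi_power: "chi (x ^ q) = chi x" "chi (x ^ 4) = chi x" "chi (x ^ 8) = chi x"
  using chi_power2[of x e] chi_power2[of x 2] chi_power2[of x 3] by (simp_all add: q_eq)

text \<open>The terms \<open>i\<close> and \<open>i + e\<close> of the trace agree on
  \<open>K\<close> and cancel in characteristic two.\<close>

lemma chi_K:
  assumes "x \<in> K"
  shows "chi x = 1"
proof -
  have q: "x ^ 2 ^ (i + e) = x ^ 2 ^ i" for i
  proof -
    have "x ^ 2 ^ (i + e) = (x ^ q) ^ 2 ^ i"
      by (simp add: q_eq power_add mult.commute flip: power_mult)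
    then show ?thesis using assms K_iff by simp
  qed
  have "tr x = (\<Sum>i\<in>{0..<e}. x ^ 2 ^ i) + (\<Sum>i\<in>{0+e..<e+e}. x ^ 2 ^ i)"
    using sum.atLeastLessThan_concat[of 0 e "e + e" "\<lambda>i. x ^ 2 ^ i"]
    by (simp add: tr_def mult_2 lessThan_atLeast0)
  also have "\<dots> = (\<Sum>i\<in>{0..<e}. x ^ 2 ^ i) + (\<Sum>i\<in>{0..<e}. x ^ 2 ^ i)"
    by (subst sum.shift_bounds_nat_ivl) (simp add: q)
  finally show ?thesis by (simp add: chi_def)
qed

text \<open>The trace is a polynomial function of degree below the size of the field, and its linear
  coefficient is 1, so it cannot vanish everywhere.\<close>

lemma ex_chi_neg: "\<exists>x. chi x = - 1"
proof (rule ccontr)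
  assume "\<not> ?thesis"
  then have tr0: "tr x = 0" for x
    using tr_cases[of x] by (metis chi_def)
  define p :: "'a poly" where "p = (\<Sum>i<2*e. monom 1 (2 ^ i))"
  have "coeff p 1 = (\<Sum>i<2*e. if (2::nat) ^ i = 1 then 1 else 0)"
    by (simp add: p_def coeff_sum)
  also have "\<dots> = (\<Sum>i<2*e. if i = 0 then 1 else 0)"
    by (rule sum.cong) auto
  also have "\<dots> = 1" using e_pos by simp
  finally have p0: "p \<noteq> 0" by auto
  have "degree (monom (1::'a) (2 ^ i)) \<le> 2 ^ (2 * e - 1)" if "i < 2 * e" for i
    using that by (simp add: degree_monom_eq)
  then have "degree p \<le> 2 ^ (2 * e - 1)"
    unfolding p_def by (intro degree_sum_le) auto
  also have "\<dots> < (2::nat) ^ (2 * e)"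
    using e_pos by (intro power_strict_increasing) auto
  also have "\<dots> = card {x. poly p x = 0}"
    using tr0 by (simp add: p_def poly_sum poly_monom tr_def card_F q_sq_eq)
  also have "\<dots> \<le> degree p"
    by (rule card_poly_roots_bound[OF p0])
  finally show False by simp
qed

lemma sum_shift: "(\<Sum>x\<in>UNIV. f (x + c)) = (\<Sum>x\<in>UNIV. f (x::'a))"
  by (rule sum.reindex_bij_witness[of _ "\<lambda>y. y - c" "\<lambda>x. x + c"]) simp_all

lemma sum_chi: "(\<Sum>x\<in>UNIV. chi (b * x)) = (if b = 0 then int (q\<^sup>2) else 0)"
proof (cases "b = 0")
  case False
  obtain z where z: "chi z = - 1" using ex_chi_neg by blast
  have "(\<Sum>x\<in>UNIV. chi (b * x)) = (\<Sum>x\<in>UNIV. chi (b * (x + z / b)))"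
    by (rule sum_shift[symmetric])
  also have "\<dots> = - (\<Sum>x\<in>UNIV. chi (b * x))"
    using False by (simp add: distrib_left chi_add z sum_negf)
  finally show ?thesis using False by simp
qed (simp add: card_F)

end

section \<open>Cube classes and the permutation\<close>

context quadratic_extension
begin

text \<open>With \<open>q = 3 * l + 1\<close>, the polynomial X^l - 1 has too few roots to vanish on
  \<open>K - {0}\<close>. As \<open>cubord = (q + 1) * l\<close>, the cubic character of the large
  field restricts on \<open>K\<close> to the square of \<open>g ^ l\<close>, and squaring is
  injective on cube roots of unity. So a noncube of \<open>K\<close> remains a noncube in the large
  field.\<close>

lemma ex_noncube: "\<exists>g\<in>K. g ^ cubord \<noteq> 1 \<and> g \<noteq> 0"
proof -
  obtain l where l: "q = 3 * l + 1" "l > 0" by (rule q_eq_3)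
  let ?p = "monom 1 l + [:-1:] :: 'a poly"
  have deg: "degree ?p = l"
    using l by (subst degree_add_eq_left) (auto simp: degree_monom_eq)
  have p0: "?p \<noteq> 0" using deg l by (metis degree_0 less_irrefl)
  have "card {x. poly ?p x = 0} \<le> l"
    using card_poly_roots_bound[OF p0] deg by simp
  also have "l < card (K - {0})"
    using K_closed(1) l by (simp add: card_K)
  finally have "\<not> K - {0} \<subseteq> {x. poly ?p x = 0}"
    using card_mono[of "{x. poly ?p x = 0}" "K - {0}"] by auto
  then obtain g where g: "g \<in> K" "g \<noteq> 0" "g ^ l \<noteq> 1"
    by (auto simp: poly_monom add_eq_0_iff_eq)
  have gq: "g ^ q = g" using g K_iff by simp
  have "3 * cubord = 3 * (l * (q + 1))"
    unfolding cubord unfolding l(1) by (simp add: power2_eq_square algebra_simps)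
  then have "cubord = (q + 1) * l" by (simp only: mult_cancel1) simp
  then have "g ^ cubord = (g ^ q * g) ^ l" by (simp only: power_mult power_add power_one_right)
  also have "\<dots> = (g ^ l)\<^sup>2" by (simp add: gq power_mult_distrib power2_eq_square)
  finally have 2: "g ^ cubord = (g ^ l)\<^sup>2" .
  have "g * (g ^ l) ^ 3 = g ^ (3 * l + 1)" by (simp add: mult.commute flip: power_mult)
  also have "\<dots> = g" using gq l by simp
  finally have 3: "(g ^ l) ^ 3 = 1" using g by simp
  have "(g ^ l)\<^sup>2 \<noteq> 1"
  proof
    assume "(g ^ l)\<^sup>2 = 1"
    then have "(g ^ l) ^ 3 = g ^ l" by (simp add: power3_eq_cube power2_eq_square)
    then show False using 3 g by simp
  qed
  with g 2 show ?thesis by metis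
qed

lemma power_1_mod_3:
  assumes "x ^ 3 = (1::'a)"
  shows "x ^ q = x"
proof -
  obtain l where l: "q = 3 * l + 1" "l > 0" by (rule q_eq_3)
  then show ?thesis using assms by (simp add: power_add power_mult)
qed

text \<open>Factors as \<open>(y ^ q + \<omega> * y) * (y ^ q + \<omega>\<^sup>2 * y)\<close> for a
  primitive cube root of unity \<omega>.\<close>

definition cnorm :: "'a \<Rightarrow> 'a" where "cnorm y = y\<^sup>2 + y * y ^ q + (y ^ q)\<^sup>2"

lemma cnorm_K: "cnorm y ^ q = cnorm y"
proof -
  have "(z\<^sup>2) ^ q = (z ^ q)\<^sup>2" for z :: 'a by (metis power_mult mult.commute)
  then show ?thesis
    by (simp add: cnorm_def power_add_char2 power_mult_distrib add_ac mult.commute)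
qed

text \<open>At a zero, \<open>r = y ^ q / y\<close> would be a primitive cube root of unity. Such an
  \<open>r\<close> is fixed by the \<open>q\<close>-th power, which also inverts it; so
  \<open>r * r = 1\<close>, and then \<open>r = 1\<close>.\<close>

lemma cnorm_nonzero:
  assumes "y \<noteq> 0"
  shows "cnorm y \<noteq> 0"
proof
  assume 0: "cnorm y = 0"
  define r where "r = y ^ q / y"
  have "r\<^sup>2 + r + 1 = cnorm y / y\<^sup>2"
    using assms by (simp add: r_def cnorm_def field_simps power2_eq_square)
  then have r: "r\<^sup>2 + r + 1 = 0" using 0 by simp
  have "r ^ 3 - 1 = (r - 1) * (r\<^sup>2 + r + 1)"
    by (simp add: algebra_simps power2_eq_square power3_eq_cube)
  then have r3: "r ^ 3 = 1" using r by simp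
  then have "r = r ^ q" by (simp add: power_1_mod_3)
  also have "\<dots> = y / y ^ q" by (simp add: r_def power_divide)
  finally have "r * r = (y ^ q / y) * (y / y ^ q)" by (metis r_def)
  then have "r * r = 1" using assms by simp
  then have "r = 1" using r3 by (simp add: power3_eq_cube)
  then show False using r by simp
qed

section \<open>The trinomial on multiples by \<open>K\<close> and on cubes\<close>

definition dexp :: nat where "dexp = (q\<^sup>2 + q + 1) div 3"

abbreviation sig :: "'a \<Rightarrow> 'a" where "sig \<equiv> poly (sigma q)"

lemma sig_eq: "sig x = x + x ^ (dexp) + (x ^ (dexp)) ^ q"
  unfolding sigma_def Let_def dexp_def[symmetric] by (simp add: poly_monom power_mult)

lemma dexp_eq: "q = 3 * l + 1 \<Longrightarrow> dexp = 3 * l * (l + 1) + 1"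
proof -
  assume l: "q = 3 * l + 1"
  have "q\<^sup>2 + q + 1 = 3 * (3 * l * (l + 1) + 1)"
    unfolding l by (simp add: power2_eq_square algebra_simps)
  then show ?thesis unfolding dexp_def by simp
qed

lemma three_dexp: "3 * dexp = q\<^sup>2 + q + 1"
proof -
  obtain l where l: "q = 3 * l + 1" "l > 0" by (rule q_eq_3)
  show ?thesis unfolding dexp_eq[OF l(1)] unfolding l(1)
    by (simp add: power2_eq_square algebra_simps)
qed

text \<open>For \<open>q = 3 * l + 1\<close> the exponent satisfies
  \<open>dexp - 1 = (l + 1) * (q - 1)\<close>.\<close>

lemma K_power_d:
  assumes "c \<in> K"
  shows "c ^ (dexp) = c"
proof (cases "c = 0")
  case True
  moreover have "dexp \<noteq> 0" using three_dexp by auto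
  ultimately show ?thesis by simp
next
  case False
  obtain l where l: "q = 3 * l + 1" "l > 0" by (rule q_eq_3)
  note d = dexp_eq[OF l(1)]
  have "c * c ^ (3 * l) = c"
    using assms K_iff[of c] l by simp
  then have "c ^ (3 * l) = 1" using False by simp
  then show ?thesis unfolding d by (simp only: power_add power_mult) simp
qed

lemma sig_scale: "c \<in> K \<Longrightarrow> sig (c * x) = c * sig x"
  using K_iff[of c] by (simp add: sig_eq power_mult_distrib K_power_d algebra_simps)

lemma sig_cube: "sig (y ^ 3) = y * cnorm y"
proof -
  have "(y ^ 3) ^ (dexp) = y\<^sup>2 * y ^ q"
    by (simp only: three_dexp power_add power_q_sq flip: power_mult) (simp add: power2_eq_square)
  moreover have "(y\<^sup>2 * y ^ q) ^ q = (y ^ q)\<^sup>2 * y"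
    by (simp add: power2_eq_square power_mult_distrib)
  ultimately show ?thesis
    by (simp add: sig_eq cnorm_def power2_eq_square power3_eq_cube algebra_simps)
qed

end

locale quadratic_extension_noncube = quadratic_extension K e q
  for K :: "'a::finite_field set" and e q +
  fixes g :: 'a
  assumes g_K: "g \<in> K" and g_noncube: "g ^ cubord \<noteq> 1" and g_nonzero: "g \<noteq> 0"
begin

definition \<omega> :: 'a where "\<omega> = g ^ cubord"

lemma \<omega>_cube: "\<omega> ^ 3 = 1"
proof -
  have "\<omega> ^ 3 = g ^ (3 * cubord)" by (simp add: \<omega>_def mult.commute flip: power_mult)
  then show ?thesis using power_order_eq_1[OF g_nonzero] by (simp add: cubord)
qed

lemma \<omega>_neq_1: "\<omega> \<noteq> 1"
  using g_noncube by (simp add: \<omega>_def)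

lemma \<omega>_sq: "\<omega>\<^sup>2 = \<omega> + 1"
proof -
  have "(\<omega> - 1) * (\<omega>\<^sup>2 + \<omega> + 1) = 0"
    using \<omega>_cube by (simp add: algebra_simps power2_eq_square power3_eq_cube)
  then have "\<omega>\<^sup>2 + (\<omega> + 1) = 0" using \<omega>_neq_1 by (simp add: add.assoc)
  then show ?thesis by (simp add: add_eq_0_iff_eq)
qed

lemma \<omega>_nonzero: "\<omega> \<noteq> 0"
  using \<omega>_cube by auto

lemma \<omega>_distinct: "\<omega>\<^sup>2 \<noteq> 1" "\<omega>\<^sup>2 \<noteq> \<omega>"
  using \<omega>_sq \<omega>_nonzero by auto

lemma \<omega>_q: "\<omega> ^ q = \<omega>"
  using \<omega>_cube by (rule power_1_mod_3)

lemma cube_eq_1: "z ^ 3 = 1 \<longleftrightarrow> z \<in> {1, \<omega>, \<omega>\<^sup>2}"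
proof -
  have w: "\<omega> * \<omega> = \<omega> + 1" using \<omega>_sq by (simp add: power2_eq_square)
  have w': "\<omega> * (\<omega> * x) = \<omega> * x + x" for x
    by (metis w mult.assoc distrib_right mult_1)
  have "z ^ 3 - 1 = (z - 1) * (z - \<omega>) * (z - \<omega>\<^sup>2)"
    unfolding \<omega>_sq diff_eq_add by (simp add: algebra_simps power3_eq_cube w w')
  then have "z ^ 3 = 1 \<longleftrightarrow> (z - 1) * (z - \<omega>) * (z - \<omega>\<^sup>2) = 0"
    by (metis eq_iff_diff_eq_0)
  then show ?thesis by auto
qed

text \<open>Representatives of the nonzero elements modulo cubes. They are chosen inside
  \<open>K\<close> so that they can be pulled out of \<open>sig\<close>.\<close>

definition reps :: "'a set" where "reps = {1, g, g\<^sup>2}"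

lemma reps_nonzero: "c \<in> reps \<Longrightarrow> c \<noteq> 0"
  using g_nonzero by (auto simp: reps_def)

lemma reps_K: "c \<in> reps \<Longrightarrow> c \<in> K"
  using g_K K_closed K_power by (auto simp: reps_def)

lemma reps_cubord: "1 ^ cubord = (1::'a)" "g ^ cubord = \<omega>" "(g\<^sup>2) ^ cubord = \<omega>\<^sup>2"
  by (simp_all add: \<omega>_def mult.commute flip: power_mult)

lemma inj_reps: "inj_on (\<lambda>c. c ^ cubord) reps"
  unfolding reps_def using \<omega>_distinct \<omega>_neq_1 by (auto simp: inj_on_def reps_cubord)

lemma card_reps: "card reps = 3"
proof -
  have "(\<lambda>c. c ^ cubord) ` reps = {1, \<omega>, \<omega>\<^sup>2}"
    unfolding reps_def by (simp add: reps_cubord)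
  moreover have "card {1, \<omega>, \<omega>\<^sup>2} = 3"
    using \<omega>_distinct[symmetric] \<omega>_neq_1[symmetric] by simp
  ultimately show ?thesis using card_image[OF inj_reps] by simp
qed

lemma sum_reps: "(\<Sum>c\<in>reps. f c) = f 1 + f g + f (g\<^sup>2)"
proof -
  have "1 \<noteq> g" "1 \<noteq> g\<^sup>2" "g \<noteq> g\<^sup>2"
    using \<omega>_distinct \<omega>_neq_1 reps_cubord by metis+
  then show ?thesis by (simp add: reps_def add.assoc)
qed

lemma cubord_cube: "z \<noteq> 0 \<Longrightarrow> (z ^ 3) ^ cubord = (1::'a)"
  using power_order_eq_1[of z] by (simp add: cubord flip: power_mult)

lemma cubord_mult_cube: "z \<noteq> 0 \<Longrightarrow> (c * z ^ 3) ^ cubord = (c::'a) ^ cubord"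
  by (simp add: power_mult_distrib cubord_cube)

text \<open>The cubic character of \<open>x\<close> determines \<open>c\<close>, and then
  \<open>y\<close> is determined up to a cube root of unity; so no fibre has more than three
  elements. There are three times as many pairs as nonzero \<open>x\<close>, so every fibre has
  exactly three.\<close>

lemma card_cube_fibre:
  assumes "x \<noteq> 0"
  shows "card {(c, y). c \<in> reps \<and> y \<noteq> 0 \<and> c * y ^ 3 = x} = 3"
proof -
  define D where "D = reps \<times> (UNIV - {0::'a})"
  define h where "h = (\<lambda>(c, y). c * y ^ 3 :: 'a)"
  define fib where "fib = (\<lambda>x. {p \<in> D. h p = x})"
  have le: "card (fib x) \<le> 3" for x
  proof (cases "fib x = {}")
    case False
    then obtain c y where cy: "c \<in> reps" "y \<noteq> 0" "c * y ^ 3 = x"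
      by (auto simp: fib_def D_def h_def)
    have "fib x \<subseteq> (\<lambda>z. (c, z * y)) ` {1, \<omega>, \<omega>\<^sup>2}"
    proof
      fix p assume "p \<in> fib x"
      then obtain c' y' where p: "p = (c', y')" "c' \<in> reps" "y' \<noteq> 0" "c' * y' ^ 3 = x"
        by (auto simp: fib_def D_def h_def)
      have "c' ^ cubord = (c' * y' ^ 3) ^ cubord"
        by (simp only: cubord_mult_cube[OF p(3)])
      also have "\<dots> = (c * y ^ 3) ^ cubord" using p cy by simp
      also have "\<dots> = c ^ cubord"
        by (simp only: cubord_mult_cube[OF cy(2)])
      finally have "c' = c" using inj_reps p cy by (auto dest: inj_onD)
      then have "(y' / y) ^ 3 = 1"
        using p cy reps_nonzero[of c] by (auto simp: power_divide)
      then have "y' / y \<in> {1, \<omega>, \<omega>\<^sup>2}" by (simp only: cube_eq_1)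
      moreover have "y' = y' / y * y" using cy by simp
      ultimately show "p \<in> (\<lambda>z. (c, z * y)) ` {1, \<omega>, \<omega>\<^sup>2}"
        using \<open>c' = c\<close> p(1) by blast
    qed
    then have "card (fib x) \<le> card ((\<lambda>z. (c, z * y)) ` {1, \<omega>, \<omega>\<^sup>2})"
      by (intro card_mono) auto
    also have "\<dots> \<le> card {1, \<omega>, \<omega>\<^sup>2}" by (rule card_image_le) simp
    also have "\<dots> \<le> 3" by (simp add: card_insert_if)
    finally show ?thesis .
  qed simp
  have "h ` D \<subseteq> UNIV - {0}"
    using reps_nonzero by (auto simp: D_def h_def)
  then have "(\<Sum>x\<in>UNIV - {0}. card (fib x)) = card D"
    using sum.group[of D "UNIV - {0}" h "\<lambda>_. 1::nat"] by (simp add: fib_def)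
  also have "\<dots> = (\<Sum>x\<in>UNIV - {0::'a}. 3)"
    by (simp add: D_def card_reps)
  finally have eq: "(\<Sum>x\<in>UNIV - {0}. card (fib x)) = (\<Sum>x\<in>UNIV - {0::'a}. 3)" .
  have "card (fib x) = 3"
  proof (rule ccontr)
    assume "card (fib x) \<noteq> 3"
    with le[of x] have "card (fib x) < 3" by simp
    then have "(\<Sum>x\<in>UNIV - {0}. card (fib x)) < (\<Sum>x\<in>UNIV - {0::'a}. 3)"
      using le assms by (intro sum_strict_mono_ex1) auto
    then show False using eq by simp
  qed
  moreover have "fib x = {(c, y). c \<in> reps \<and> y \<noteq> 0 \<and> c * y ^ 3 = x}"
    by (auto simp: fib_def D_def h_def)
  ultimately show ?thesis by simp
qed

lemma cube_decomposition:
  assumes "x \<noteq> 0"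
  obtains c y where "c \<in> reps" "y \<noteq> 0" "c * y ^ 3 = x"
proof -
  have "{(c, y). c \<in> reps \<and> y \<noteq> 0 \<and> c * y ^ 3 = x} \<noteq> {}"
    using card_cube_fibre[OF assms] by (metis card.empty zero_neq_numeral)
  then show thesis using that by auto
qed

text \<open>Each nonzero \<open>x\<close> is hit three times by \<open>card_cube_fibre\<close>, and
  0 is hit once for each of the three representatives.\<close>

lemma sum_cube_cover:
  fixes f :: "'a \<Rightarrow> int"
  shows "(\<Sum>c\<in>reps. \<Sum>y\<in>UNIV. f (c * y ^ 3)) = 3 * (\<Sum>x\<in>UNIV. f x)"
proof -
  have split: "(\<Sum>y\<in>UNIV. h y) = h 0 + (\<Sum>y\<in>UNIV - {0}. h y)" for h :: "'a \<Rightarrow> int"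
    by (simp add: sum.remove)
  define D where "D = reps \<times> (UNIV - {0::'a})"
  have "(\<Sum>c\<in>reps. \<Sum>y\<in>UNIV - {0}. f (c * y ^ 3)) = (\<Sum>p\<in>D. f (fst p * snd p ^ 3))"
    by (simp add: D_def sum.cartesian_product case_prod_beta)
  also have "\<dots> = (\<Sum>x\<in>UNIV - {0}. \<Sum>p\<in>{p \<in> D. fst p * snd p ^ 3 = x}. f (fst p * snd p ^ 3))"
    by (rule sum.group[symmetric]) (use reps_nonzero in \<open>auto simp: D_def\<close>)
  also have "\<dots> = (\<Sum>x\<in>UNIV - {0}. 3 * f x)"
  proof (rule sum.cong)
    fix x :: 'a assume x: "x \<in> UNIV - {0}"
    have "{p \<in> D. fst p * snd p ^ 3 = x} = {(c, y). c \<in> reps \<and> y \<noteq> 0 \<and> c * y ^ 3 = x}"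
      by (auto simp: D_def)
    then have "card {p \<in> D. fst p * snd p ^ 3 = x} = 3"
      using card_cube_fibre x by simp
    moreover have "(\<Sum>p\<in>{p \<in> D. fst p * snd p ^ 3 = x}. f (fst p * snd p ^ 3)) =
        (\<Sum>p\<in>{p \<in> D. fst p * snd p ^ 3 = x}. f x)"
      by (rule sum.cong) auto
    ultimately show "(\<Sum>p\<in>{p \<in> D. fst p * snd p ^ 3 = x}. f (fst p * snd p ^ 3)) = 3 * f x"
      by simp
  qed simp
  finally show ?thesis
    by (subst (1 2) split) (simp add: sum.distrib card_reps sum_distrib_left)
qed

text \<open>Conversely, if \<open>a = y ^ 3\<close> lies in \<open>K\<close>, then
  \<open>r = y ^ q / y\<close> is a cube root of unity, hence fixed by the \<open>q\<close>-th power
  that inverts it. This forces \<open>r = 1\<close>, so \<open>y\<close> is itself in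
  \<open>K\<close>.\<close>

lemma cube_iff:
  assumes "a \<in> K" "a \<noteq> 0"
  shows "(\<exists>c\<in>K. a = c ^ 3) \<longleftrightarrow> a ^ cubord = 1"
proof
  assume "\<exists>c\<in>K. a = c ^ 3"
  then show "a ^ cubord = 1" using cubord_cube assms(2) by auto
next
  assume a: "a ^ cubord = 1"
  obtain c y where cy: "c \<in> reps" "y \<noteq> 0" "c * y ^ 3 = a"
    using assms(2) by (rule cube_decomposition)
  have "c ^ cubord = (c * y ^ 3) ^ cubord"
    by (simp only: cubord_mult_cube[OF cy(2)])
  then have "c ^ cubord = 1 ^ cubord" using cy a by simp
  then have "c = 1" using inj_reps cy(1) by (auto dest: inj_onD simp: reps_def)
  then have y3: "y ^ 3 = a" using cy by simp
  define r where "r = y ^ q / y"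
  have "r ^ 3 = (y ^ 3) ^ q / y ^ 3"
    by (simp add: r_def power_divide mult.commute flip: power_mult)
  then have r3: "r ^ 3 = 1" using y3 assms K_iff by simp
  then have "r = r ^ q" by (simp add: power_1_mod_3)
  also have "\<dots> = y / y ^ q" by (simp add: r_def power_divide)
  finally have "r * r = (y ^ q / y) * (y / y ^ q)" by (metis r_def)
  then have "r * r = 1" using cy by simp
  then have "r = 1" using r3 by (simp add: power3_eq_cube)
  then have "y ^ q = y" using cy by (simp add: r_def)
  then show "\<exists>c\<in>K. a = c ^ 3" using y3 K_iff by auto
qed

text \<open>For \<open>x = c * y ^ 3\<close> and \<open>n = cnorm y\<close>, both \<open>c\<close>
  and \<open>n\<close> lie in \<open>K\<close>. Hence \<open>sig x = c * n * y\<close> and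
  \<open>cnorm (sig x) = c\<^sup>2 * n ^ 3\<close>.\<close>

lemma sig_left_inverse: "sig x ^ 3 / cnorm (sig x) = x"
proof (cases "x = 0")
  case True
  then show ?thesis using q_ge_4 by (simp add: sig_eq power_0_left)
next
  case False
  then obtain c y where cy: "c \<in> reps" "y \<noteq> 0" "c * y ^ 3 = x"
    by (rule cube_decomposition)
  define n where "n = cnorm y"
  have n: "n \<noteq> 0" "n ^ q = n" using cy cnorm_nonzero cnorm_K by (auto simp: n_def)
  have c: "c \<noteq> 0" "c ^ q = c" using cy reps_nonzero reps_K K_iff by auto
  have s: "sig x = c * n * y"
    using cy sig_scale[of c "y ^ 3"] reps_K by (auto simp: sig_cube n_def)
  have "cnorm (sig x) = (c * n)\<^sup>2 * n"
  proof -
    have "cnorm (a * y) = a\<^sup>2 * cnorm y" if "a ^ q = a" for a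
      by (simp add: cnorm_def power_mult_distrib that power2_eq_square algebra_simps)
    then show ?thesis by (simp add: s power_mult_distrib c n n_def[symmetric])
  qed
  then show ?thesis
    using c n cy by (simp add: s field_simps power2_eq_square power3_eq_cube)
qed

lemma bij_sig: "bij sig"
proof -
  have "inj sig" by (metis injI sig_left_inverse)
  then show ?thesis using finite_UNIV_inj_surj[of sig] by (auto simp: bij_def)
qed

text \<open>Substituting \<open>sig x\<close> for the summation variable removes the inverse
  permutation.\<close>

lemma walsh_eq:
  "walsh (2 * e) (f_alpha e \<alpha>) \<beta> = (\<Sum>x\<in>UNIV. chi (\<alpha> * x ^ 3 + \<beta> * sig x))"
proof -
  have bit: "(- 1 :: int) ^ of_bool (abs_trace (2 * e) x + abs_trace (2 * e) y = 1) = chi (x + y)"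
    for x y :: 'a
    using tr_cases[of x] tr_cases[of y]
    by (auto simp: abs_trace_def chi_def tr_add simp flip: tr_def)
  have "walsh (2 * e) (f_alpha e \<alpha>) \<beta> = (\<Sum>x\<in>UNIV. chi (\<alpha> * inv sig x ^ 3 + \<beta> * x))"
    unfolding walsh_def f_alpha_def bit q_eq ..
  also have "\<dots> = (\<Sum>x\<in>UNIV. chi (\<alpha> * inv sig (sig x) ^ 3 + \<beta> * sig x))"
    by (rule sum.reindex_bij_betw[OF bij_sig, symmetric])
  finally show ?thesis using bij_sig by (simp add: bij_is_inj)
qed

end

section \<open>Quadratic forms and their radicals\<close>

context quadratic_extension
begin

definition psi :: "'a \<Rightarrow> 'a" where "psi x = (x ^ q)\<^sup>2"

lemma psi_add: "psi (x + y) = psi x + psi y"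
  by (simp add: psi_def power_add_char2)

lemma psi_mult: "psi (x * y) = psi x * psi y"
  by (simp add: psi_def power_mult_distrib)

lemma psi_power: "psi (x ^ n) = psi x ^ n"
  by (simp add: psi_def mult_ac flip: power_mult)

lemma psi_psi: "psi (psi x) = x ^ 4"
proof -
  have "psi (psi x) = ((x ^ q) ^ q) ^ 4"
    by (simp add: psi_def mult_ac flip: power_mult del: power_q_q)
  then show ?thesis by simp
qed

lemma psi_0 [simp]: "psi 0 = 0" and psi_1 [simp]: "psi 1 = 1"
  using q_ge_4 by (simp_all add: psi_def power_0_left)

lemma bij_psi: "bij psi"
proof -
  have "inj psi"
  proof (rule injI)
    fix x y assume "psi x = psi y"
    then have "psi (x + y) = 0" by (simp add: psi_add)
    then have "(x + y) ^ q = 0" by (simp add: psi_def)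
    then have "((x + y) ^ q) ^ q = 0" using q_ge_4 by (simp add: power_0_left)
    then show "x = y" by (simp add: add_eq_0_iff_eq)
  qed
  then show ?thesis using finite_UNIV_inj_surj[of psi] by (auto simp: bij_def)
qed

text \<open>The factor \<open>(u ^ q) ^ 8\<close> is \<open>psi\<close> applied three times to
  \<open>u\<close>, and \<open>(u ^ q)\<^sup>2\<close> is \<open>psi u\<close>.\<close>

definition quad :: "'a \<Rightarrow> 'a \<Rightarrow> 'a \<Rightarrow> 'a" where
  "quad a b u = a * (u * (u ^ q) ^ 8) + b * (u * (u ^ q)\<^sup>2)"

text \<open>For \<open>a\<close> in \<open>K\<close>, the radical of the bilinear form obtained by
  polarising the trace of \<open>quad a b\<close>; see \<open>quad_add\<close>.\<close>

definition radical :: "'a \<Rightarrow> 'a \<Rightarrow> 'a set" where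
  "radical a b = {w. a ^ 8 * w ^ 64 + (b ^ q) ^ 8 * w ^ 16 + b ^ 4 * w ^ 4 + a * w = 0}"

definition quad_sum :: "'a \<Rightarrow> 'a \<Rightarrow> int" where
  "quad_sum a b = (\<Sum>u\<in>UNIV. chi (quad a b u))"

text \<open>The four cross terms are brought to the common factor \<open>(u ^ q) ^ 8\<close>: two
  are raised to the power \<open>8 * q\<close>, one to the power 4, and one has it already. Such
  powers leave \<open>chi\<close> unchanged.\<close>

lemma quad_add:
  assumes a: "a ^ q = a"
  shows "chi (quad a b (u + w)) = chi (quad a b u) * chi (quad a b w) *
    chi ((a ^ 8 * w ^ 64 + (b ^ q) ^ 8 * w ^ 16 + b ^ 4 * w ^ 4 + a * w) * (u ^ q) ^ 8)"
proof -
  have f1: "quad a b (u + w) = quad a b u + quad a b w + a * (u * (w ^ q) ^ 8) + a * (w * (u ^ q) ^ 8) +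
      b * (u * (w ^ q)\<^sup>2) + b * (w * (u ^ q)\<^sup>2)"
    by (simp add: quad_def power_add_char2 algebra_simps)
  have f2: "chi (a * (u * (w ^ q) ^ 8)) = chi (a ^ 8 * w ^ 64 * (u ^ q) ^ 8)"
  proof -
    have "((a * (u * (w ^ q) ^ 8)) ^ q) ^ 8 = (a ^ q) ^ 8 * (u ^ q) ^ 8 * ((w ^ q) ^ q) ^ 64"
      by (simp add: power_mult_distrib mult_ac flip: power_mult del: power_q_q)
    then have "chi (((a * (u * (w ^ q) ^ 8)) ^ q) ^ 8) = chi (a ^ 8 * w ^ 64 * (u ^ q) ^ 8)"
      by (simp add: a mult_ac)
    then show ?thesis by (simp only: chi_power)
  qed
  have f3: "chi (b * (u * (w ^ q)\<^sup>2)) = chi ((b ^ q) ^ 8 * w ^ 16 * (u ^ q) ^ 8)"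
  proof -
    have "((b * (u * (w ^ q)\<^sup>2)) ^ q) ^ 8 = (b ^ q) ^ 8 * (u ^ q) ^ 8 * ((w ^ q) ^ q) ^ 16"
      by (simp add: power_mult_distrib mult_ac flip: power_mult del: power_q_q)
    then have "chi (((b * (u * (w ^ q)\<^sup>2)) ^ q) ^ 8) = chi ((b ^ q) ^ 8 * w ^ 16 * (u ^ q) ^ 8)"
      by (simp add: mult_ac)
    then show ?thesis by (simp only: chi_power)
  qed
  have f4: "chi (b * (w * (u ^ q)\<^sup>2)) = chi (b ^ 4 * w ^ 4 * (u ^ q) ^ 8)"
  proof -
    have "(b * (w * (u ^ q)\<^sup>2)) ^ 4 = b ^ 4 * w ^ 4 * (u ^ q) ^ 8"
      by (simp add: power_mult_distrib mult_ac flip: power_mult)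
    then show ?thesis by (metis chi_power(2))
  qed
  have f5: "a * (w * (u ^ q) ^ 8) = a * w * (u ^ q) ^ 8" by (simp add: mult_ac)
  show ?thesis
    unfolding f1 chi_add f2 f3 f4 f5 distrib_right by (simp only: mult_ac)
qed

lemma radical_add: "w \<in> radical a b \<Longrightarrow> w' \<in> radical a b \<Longrightarrow> w + w' \<in> radical a b"
proof -
  define L where "L w = a ^ 8 * w ^ 64 + (b ^ q) ^ 8 * w ^ 16 + b ^ 4 * w ^ 4 + a * w" for w
  have "L (w + w') = L w + L w'"
    by (simp add: L_def power_add_char2 distrib_left add_ac)
  then show "w \<in> radical a b \<Longrightarrow> w' \<in> radical a b \<Longrightarrow> w + w' \<in> radical a b"
    by (simp add: radical_def L_def[symmetric])
qed

lemma zero_radical: "0 \<in> radical a b"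
  by (simp add: radical_def)

lemma quad_scale:
  assumes "z ^ 3 = 1"
  shows "quad a b (z * u) = quad a b u"
proof -
  have "z ^ q = z" using assms by (rule power_1_mod_3)
  moreover have "z * z ^ 8 = (z ^ 3) ^ 3" "z * z\<^sup>2 = z ^ 3"
    by (simp_all flip: power_mult power_Suc)
  ultimately have "z * (z ^ q) ^ 8 = 1" "z * (z ^ q)\<^sup>2 = 1" using assms by simp_all
  moreover have "quad a b (z * u) = a * (z * (z ^ q) ^ 8) * (u * (u ^ q) ^ 8) +
      b * (z * (z ^ q)\<^sup>2) * (u * (u ^ q)\<^sup>2)"
    by (simp add: quad_def power_mult_distrib mult_ac)
  ultimately show ?thesis by (simp add: quad_def)
qed

lemma card_radical_le:
  assumes "a \<noteq> 0"
  shows "card (radical a b) \<le> 64"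
proof -
  let ?p = "monom (a ^ 8) 64 + (monom ((b ^ q) ^ 8) 16 + monom (b ^ 4) 4 + monom a 1)"
  have "degree (monom ((b ^ q) ^ 8) 16 + monom (b ^ 4) 4 + monom a 1) \<le> 16"
    by (intro degree_add_le order.trans[OF degree_monom_le]) simp_all
  then have deg: "degree ?p = 64"
    using assms by (subst degree_add_eq_left) (auto simp: degree_monom_eq)
  then have "?p \<noteq> 0" by (metis degree_0 zero_neq_numeral)
  from card_poly_roots_bound[OF this] show ?thesis
    by (simp only: deg) (simp add: radical_def poly_monom add_ac)
qed

end

context quadratic_extension_noncube
begin

text \<open>The sign is multiplicative on the radical and takes the same value at \<open>w\<close>,
  \<open>\<omega> * w\<close> and their sum \<open>\<omega>\<^sup>2 * w\<close>. So it equals its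
  own square.\<close>

lemma chi_quad_radical:
  assumes a: "a ^ q = a" and w: "w \<in> radical a b"
  shows "chi (quad a b w) = 1"
proof -
  have "chi (quad a b (\<omega> * w + w)) = chi (quad a b (\<omega> * w)) * chi (quad a b w)"
    using w by (simp add: quad_add[OF a] radical_def)
  moreover have "\<omega> * w + w = \<omega>\<^sup>2 * w" by (simp add: \<omega>_sq algebra_simps)
  moreover have "(\<omega>\<^sup>2) ^ 3 = 1" using \<omega>_cube by (metis power_mult mult.commute power_one)
  ultimately have "chi (quad a b w) = chi (quad a b w) * chi (quad a b w)"
    by (simp add: quad_scale \<omega>_cube)
  then show ?thesis by simp
qed

text \<open>Write the second variable as \<open>u + w\<close>. By \<open>quad_add\<close> the sum
  over \<open>u\<close> is a full character sum, which vanishes unless \<open>w\<close> is in the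
  radical, where the remaining sign is 1.\<close>

lemma quad_sum_squared:
  assumes a: "a ^ q = a"
  shows "(quad_sum a b)\<^sup>2 = int (q\<^sup>2) * int (card (radical a b))"
proof -
  let ?L = "\<lambda>w. a ^ 8 * w ^ 64 + (b ^ q) ^ 8 * w ^ 16 + b ^ 4 * w ^ 4 + a * w"
  have inner: "(\<Sum>u\<in>UNIV. chi (c * (u ^ q) ^ 8)) = (if c = 0 then int (q\<^sup>2) else 0)" for c
  proof -
    \<comment> \<open>Three applications of the bijection \<open>psi\<close> replace
      \<open>(u ^ q) ^ 8\<close> by \<open>u\<close>.\<close>
    have "(\<Sum>u\<in>UNIV. h (psi u)) = (\<Sum>u\<in>UNIV. h u)" for h :: "'a \<Rightarrow> int"
      by (rule sum.reindex_bij_betw[OF bij_psi])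
    from this[of "\<lambda>u. chi (c * psi (psi u))"] this[of "\<lambda>u. chi (c * psi u)"]
      this[of "\<lambda>u. chi (c * u)"]
    have "(\<Sum>u\<in>UNIV. chi (c * psi (psi (psi u)))) = (\<Sum>u\<in>UNIV. chi (c * u))"
      by (simp only:)
    moreover have "psi (psi (psi u)) = (u ^ q) ^ 8" for u
    proof -
      have "psi (psi (psi u)) = psi u ^ 4" by (rule psi_psi)
      also have "\<dots> = (u ^ q) ^ (2 * 4)" unfolding psi_def by (rule power_mult[symmetric])
      finally show ?thesis by simp
    qed
    ultimately have "(\<Sum>u\<in>UNIV. chi (c * (u ^ q) ^ 8)) = (\<Sum>u\<in>UNIV. chi (c * u))"
      by (simp only:)
    then show ?thesis by (simp add: sum_chi)
  qed
  have "(quad_sum a b)\<^sup>2 = (\<Sum>u\<in>UNIV. \<Sum>v\<in>UNIV. chi (quad a b u) * chi (quad a b v))"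
    by (simp add: quad_sum_def power2_eq_square sum_product)
  also have "\<dots> = (\<Sum>u\<in>UNIV. \<Sum>w\<in>UNIV. chi (quad a b u) * chi (quad a b (u + w)))"
  proof (rule sum.cong)
    fix u :: 'a
    show "(\<Sum>v\<in>UNIV. chi (quad a b u) * chi (quad a b v)) =
        (\<Sum>w\<in>UNIV. chi (quad a b u) * chi (quad a b (u + w)))"
      using sum_shift[of "\<lambda>v. chi (quad a b u) * chi (quad a b v)" u] by (simp add: add.commute)
  qed simp
  also have "\<dots> = (\<Sum>w\<in>UNIV. \<Sum>u\<in>UNIV. chi (quad a b u) * chi (quad a b (u + w)))"
    by (rule sum.swap)
  also have "\<dots> = (\<Sum>w\<in>UNIV. \<Sum>u\<in>UNIV. chi (quad a b w) * chi (?L w * (u ^ q) ^ 8))"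
  proof (intro sum.cong refl)
    fix u w :: 'a
    have "chi (quad a b u) * chi (quad a b (u + w)) =
        (chi (quad a b u) * chi (quad a b u)) * (chi (quad a b w) * chi (?L w * (u ^ q) ^ 8))"
      unfolding quad_add[OF a] by (simp only: mult.assoc)
    then show "chi (quad a b u) * chi (quad a b (u + w)) = chi (quad a b w) * chi (?L w * (u ^ q) ^ 8)"
      by simp
  qed
  also have "\<dots> = (\<Sum>w\<in>UNIV. chi (quad a b w) * (if ?L w = 0 then int (q\<^sup>2) else 0))"
    by (simp only: sum_distrib_left[symmetric] inner)
  also have "\<dots> = (\<Sum>w\<in>UNIV. if w \<in> radical a b then int (q\<^sup>2) else 0)"
    using chi_quad_radical[OF a] by (intro sum.cong) (auto simp: radical_def)
  also have "\<dots> = int (q\<^sup>2) * int (card (radical a b))"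
    by (subst sum.inter_filter[symmetric]) simp_all
  finally show ?thesis .
qed

text \<open>Multiplication by cube roots of unity splits the nonzero \<open>u\<close> into orbits of
  size three on which \<open>quad\<close> is constant; only \<open>u = 0\<close> is left. This
  congruence fixes the sign that \<open>quad_sum_squared\<close> leaves open.\<close>

lemma quad_sum_mod_3: "quad_sum a b mod 3 = 1"
proof -
  define f where "f u = chi (quad a b u)" for u
  let ?S = "UNIV - {0::'a}"
  have "3 dvd (\<Sum>u\<in>{u \<in> ?S. u ^ 3 = x}. f u)" if x: "x \<in> (\<lambda>u. u ^ 3) ` ?S" for x
  proof -
    obtain u0 where u0: "u0 \<noteq> 0" "x = u0 ^ 3" using x by auto
    have "{u \<in> ?S. u ^ 3 = x} = (\<lambda>z. z * u0) ` {z. z ^ 3 = 1}"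
    proof (intro equalityI subsetI)
      fix u assume "u \<in> {u \<in> ?S. u ^ 3 = x}"
      then have "(u / u0) ^ 3 = 1" "u = u / u0 * u0" using u0 by (auto simp: power_divide)
      then show "u \<in> (\<lambda>z. z * u0) ` {z. z ^ 3 = 1}" by blast
    next
      fix u assume "u \<in> (\<lambda>z. z * u0) ` {z. z ^ 3 = 1}"
      then show "u \<in> {u \<in> ?S. u ^ 3 = x}" using u0 by (auto simp: power_mult_distrib)
    qed
    moreover have "inj_on (\<lambda>z. z * u0) {z. z ^ 3 = 1}" using u0 by (auto simp: inj_on_def)
    ultimately have "(\<Sum>u\<in>{u \<in> ?S. u ^ 3 = x}. f u) = (\<Sum>z\<in>{z. z ^ 3 = 1}. f (z * u0))"
      by (simp add: sum.reindex)
    also have "\<dots> = (\<Sum>z\<in>{z::'a. z ^ 3 = 1}. f u0)"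
      by (intro sum.cong) (auto simp: f_def quad_scale)
    also have "\<dots> = 3 * f u0"
      using \<omega>_distinct[symmetric] \<omega>_neq_1[symmetric] by (simp only: cube_eq_1 Collect_mem_eq) simp
    finally show ?thesis by simp
  qed
  then have "3 dvd (\<Sum>x\<in>(\<lambda>u. u ^ 3) ` ?S. \<Sum>u\<in>{u \<in> ?S. u ^ 3 = x}. f u)"
    by (rule dvd_sum)
  also have "\<dots> = (\<Sum>u\<in>?S. f u)" by (rule sum.group) auto
  finally have "3 dvd (\<Sum>u\<in>?S. f u)" .
  moreover have "quad_sum a b = f 0 + (\<Sum>u\<in>?S. f u)"
    by (simp add: quad_sum_def f_def sum.remove)
  moreover have "f 0 = 1" by (simp add: f_def quad_def)
  ultimately show ?thesis by presburger
qed

end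

section \<open>The semilinear equation of the radical\<close>

definition ring_endo :: "('a::comm_ring_1 \<Rightarrow> 'a) \<Rightarrow> bool" where
  "ring_endo f \<longleftrightarrow> f 1 = 1 \<and> (\<forall>x y. f (x + y) = f x + f y) \<and> (\<forall>x y. f (x * y) = f x * f y)"

definition vec_map :: "('a \<Rightarrow> 'a) \<Rightarrow> 'a ^ 'n \<Rightarrow> 'a ^ 'n" where
  "vec_map f v = (\<chi> i. f (v $ i))"

definition mat_map :: "('a \<Rightarrow> 'a) \<Rightarrow> 'a ^ 'n ^ 'm \<Rightarrow> 'a ^ 'n ^ 'm" where
  "mat_map f A = (\<chi> i j. f (A $ i $ j))"

lemma ring_endo_simps:
  assumes "ring_endo f"
  shows "f 0 = 0" "f 1 = 1" "f (x + y) = f x + f y" "f (x * y) = f x * f y"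
    "f (- x) = - f x" "f (x - y) = f x - f y" "f (x ^ n) = f x ^ n"
    "f (\<Sum>i\<in>S. g i) = (\<Sum>i\<in>S. f (g i))"
proof -
  show 1: "f 1 = 1" and add: "f (x + y) = f x + f y" and mult: "f (x * y) = f x * f y" for x y
    using assms by (auto simp: ring_endo_def)
  show 0: "f 0 = 0" using add[of 0 0] by simp
  show neg: "f (- x) = - f x" for x
    using add[of x "- x"] 0 by (simp add: eq_neg_iff_add_eq_0 add.commute)
  show "f (x - y) = f x - f y" using add[of x "- y"] neg by simp
  show "f (x ^ n) = f x ^ n" by (induction n) (simp_all add: 1 mult)
  show "f (\<Sum>i\<in>S. g i) = (\<Sum>i\<in>S. f (g i))"
    by (induction S rule: infinite_finite_induct) (simp_all add: 0 add)
qed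

lemma mat_map_mult: "ring_endo f \<Longrightarrow> mat_map f (A ** B) = mat_map f A ** mat_map f B"
  by (simp add: mat_map_def matrix_matrix_mult_def vec_eq_iff ring_endo_simps)

lemma mat_map_vec_map: "ring_endo f \<Longrightarrow> mat_map f A *v vec_map f v = vec_map f (A *v v)"
  by (simp add: mat_map_def vec_map_def matrix_vector_mult_def vec_eq_iff ring_endo_simps)

lemma mat_map_add: "ring_endo f \<Longrightarrow> mat_map f (A + B) = mat_map f A + mat_map f B"
  by (simp add: mat_map_def vec_eq_iff ring_endo_simps)

lemma mat_map_mat: "ring_endo f \<Longrightarrow> mat_map f (mat c) = mat (f c)"
  by (simp add: mat_map_def mat_def vec_eq_iff ring_endo_simps)

lemma mat_map_mat_map: "mat_map f (mat_map h A) = mat_map (\<lambda>x. f (h x)) A"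
  by (simp add: mat_map_def vec_eq_iff)

lemma vec_map_vec_map: "vec_map f (vec_map h v) = vec_map (\<lambda>x. f (h x)) v"
  by (simp add: vec_map_def vec_eq_iff)

lemma vec_map_id [simp]: "vec_map (\<lambda>x. x) v = v"
  by (simp add: vec_map_def vec_eq_iff)

lemma mat_map_id [simp]: "mat_map (\<lambda>x. x) A = A"
  by (simp add: mat_map_def vec_eq_iff)

lemma vec_map_scale: "ring_endo f \<Longrightarrow> vec_map f (c *s v) = f c *s vec_map f v"
  by (simp add: vec_map_def vec_eq_iff ring_endo_simps)

lemma vec_map_add: "ring_endo f \<Longrightarrow> vec_map f (v + w) = vec_map f v + vec_map f w"
  by (simp add: vec_map_def vec_eq_iff ring_endo_simps)

lemma det_mat_map: "ring_endo f \<Longrightarrow> det (mat_map f (A :: 'a::comm_ring_1 ^ 3 ^ 3)) = f (det A)"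
  by (simp add: det_3 ring_endo_simps mat_map_def)

lemma matrix_mult_scale: "A *v (c *s v) = c *s (A *v (v :: 'a::comm_ring_1 ^ 'n))"
  by (simp add: matrix_vector_mult_def vec_eq_iff sum_distrib_left mult_ac)

lemma mat_vector: "mat c *v (v :: 'a::comm_ring_1 ^ 'n) = c *s v"
proof (unfold vec_eq_iff, rule allI)
  fix i
  have "(\<Sum>j\<in>UNIV. (if i = j then c else 0) * v $ j) = (\<Sum>j\<in>UNIV. if i = j then c * v $ j else 0)"
    by (rule sum.cong) auto
  then show "(mat c *v v) $ i = (c *s v) $ i"
    by (simp add: mat_def matrix_vector_mult_def)
qed

lemma matrix_mult_add_rdistrib: "(A + B) ** C = A ** C + B ** (C :: 'a::comm_ring_1 ^ 'n ^ 'm)"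
  by (simp add: matrix_matrix_mult_def vec_eq_iff distrib_right sum.distrib)

lemma transpose_mat_map: "transpose (mat_map f A) = mat_map f (transpose A)"
  by (simp add: transpose_def mat_map_def vec_eq_iff)

lemma matrix_eqI_mult: "(\<And>v. A *v v = B *v (v :: 'a::comm_ring_1 ^ 'n)) \<Longrightarrow> A = B"
  by (simp add: matrix_eq)

lemma mat_commute: "A ** mat c = mat c ** (A :: 'a::comm_ring_1 ^ 'n ^ 'n)"
  by (rule matrix_eqI_mult) (simp add: mat_vector matrix_mult_scale flip: matrix_vector_mul_assoc)

lemma mat_mat_mult: "mat c ** mat d = (mat (c * d) :: 'a::comm_ring_1 ^ 'n ^ 'n)"
  by (rule matrix_eqI_mult) (simp add: mat_vector vec_eq_iff mult_ac flip: matrix_vector_mul_assoc)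

lemma det_mat: "det (mat c :: 'a::comm_ring_1 ^ 3 ^ 3) = c ^ 3"
  by (simp add: det_3 mat_def power3_eq_cube)

lemma det_eq_0_iff_kernel:
  "det (A :: 'a::field ^ 'n ^ 'n) = 0 \<longleftrightarrow> (\<exists>v. v \<noteq> 0 \<and> A *v v = 0)"
  using matrix_left_invertible_ker[of A] invertible_left_inverse[of A] invertible_det_nz[of A]
  by blast

section \<open>The iterated companion matrix and its eigenvectors\<close>

context quadratic_extension
begin

definition tau :: "nat \<Rightarrow> 'a \<Rightarrow> 'a" where "tau i x = x ^ 4 ^ i"

lemma ring_endo_tau: "ring_endo (tau i)"
proof -
  have "(4::nat) ^ i = 2 ^ (2 * i)" by (simp add: power_mult)
  then show ?thesis
    by (simp add: ring_endo_def tau_def power_mult_distrib power_two_add)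
qed

lemma ring_endo_psi: "ring_endo psi"
  by (simp add: ring_endo_def psi_add psi_mult)

lemma tau_tau: "tau i (tau j x) = tau (i + j) x"
  by (simp add: tau_def power_add mult.commute flip: power_mult)

lemma tau_e: "tau e x = x"
  using power_q_sq[of x] by (simp only: tau_def q_sq_eq(2))

lemma tau_0 [simp]: "tau 0 x = x"
  by (simp add: tau_def)

lemma tau_1: "tau 1 x = x ^ 4" "tau (Suc 0) x = x ^ 4"
  by (simp_all add: tau_def)

lemma mat_map_tau_0: "mat_map (tau 0) A = A" "mat_map (tau e) A = A"
  and vec_map_tau_0: "vec_map (tau 0) v = v" "vec_map (tau e) v = v"
  by (simp_all add: mat_map_def vec_map_def tau_e)

text \<open>For nonzero \<open>a\<close>, an element \<open>u\<close> is in
  \<open>radical a b\<close> iff this matrix sends (u, u^4, u^16) to its entrywise fourth power; the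
  last row is the radical equation solved for \<open>u ^ 64\<close>.\<close>

definition companion :: "'a \<Rightarrow> 'a \<Rightarrow> 'a ^ 3 ^ 3" where
  "companion a b = vector [vector [0, 1, 0], vector [0, 0, 1],
     vector [a / a ^ 8, b ^ 4 / a ^ 8, (b ^ q) ^ 8 / a ^ 8]]"

lemma companion_mult: "companion a b *v v = vector [v $ 2, v $ 3,
    (a * v $ 1 + b ^ 4 * v $ 2 + (b ^ q) ^ 8 * v $ 3) / a ^ 8]"
  by (simp add: companion_def vec_eq_iff forall_3 matrix_vector_mult_def sum_3 add_divide_distrib)

lemma det_companion: "det (companion a b) = a / a ^ 8"
  by (simp add: companion_def det_3)

text \<open>The product of the Frobenius twists of \<open>companion a b\<close>, with the untwisted
  factor on the right. \<open>trans_mat_Suc\<close> peels off the most twisted factor on the left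
  instead.\<close>

primrec trans_mat :: "'a \<Rightarrow> 'a \<Rightarrow> nat \<Rightarrow> 'a ^ 3 ^ 3" where
  "trans_mat a b 0 = mat 1"
| "trans_mat a b (Suc i) = mat_map (tau 1) (trans_mat a b i) ** companion a b"

lemma trans_mat_Suc: "trans_mat a b (Suc i) = mat_map (tau i) (companion a b) ** trans_mat a b i"
proof (induction i)
  case 0
  then show ?case by (simp add: mat_map_mat[OF ring_endo_tau] mat_map_tau_0 ring_endo_simps(2)[OF ring_endo_tau])
next
  case (Suc i)
  have "trans_mat a b (Suc (Suc i)) =
      mat_map (tau 1) (mat_map (tau i) (companion a b) ** trans_mat a b i) ** companion a b"
    using Suc by simp
  also have "\<dots> = mat_map (tau (Suc i)) (companion a b) ** trans_mat a b (Suc i)"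
    by (simp add: mat_map_mult[OF ring_endo_tau] mat_map_mat_map tau_tau matrix_mul_assoc)
  finally show ?case .
qed

text \<open>The exponent of \<open>c\<close> that accumulates when \<open>v\<close> is mapped
  \<open>i\<close> times to \<open>c\<close> times its fourth power; after \<open>e\<close> rounds
  it is the exponent of the cubic character.\<close>

definition geo :: "nat \<Rightarrow> nat" where "geo i = (\<Sum>j<i. 4 ^ j)"

lemma geo_simps: "geo 0 = 0" "geo (Suc i) = geo i + 4 ^ i" "geo (Suc i) = 4 * geo i + 1"
proof -
  show "geo 0 = 0" "geo (Suc i) = geo i + 4 ^ i" for i by (simp_all add: geo_def)
  then show "geo (Suc i) = 4 * geo i + 1" by (induction i) auto
qed

lemma geo_e: "geo e = cubord"
proof -
  have "3 * geo i + 1 = 4 ^ i" for i by (induction i) (simp_all add: geo_simps)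
  from this[of e] have "3 * geo e = q\<^sup>2 - 1" unfolding q_sq_eq(2) by linarith
  then show ?thesis using cubord by simp
qed

lemma det_trans_mat: "det (trans_mat a b e) = (a / a ^ 8) ^ cubord"
proof -
  have "det (trans_mat a b i) = (a / a ^ 8) ^ geo i" for i
  proof (induction i)
    case (Suc i)
    have "det (trans_mat a b (Suc i)) = ((a / a ^ 8) ^ geo i) ^ 4 * (a / a ^ 8)"
      by (simp add: det_mul det_mat_map[OF ring_endo_tau] Suc det_companion tau_1)
    also have "\<dots> = (a / a ^ 8) ^ (geo i * 4 + 1)" by (simp only: power_add power_mult power_one_right)
    also have "geo i * 4 + 1 = geo (Suc i)" by (simp only: geo_simps(3) mult.commute)
    finally show ?case .
  qed (simp add: geo_simps)
  then show ?thesis by (simp add: geo_e)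
qed

lemma semilinear_imp_eigen:
  assumes "companion a b *v v = c *s vec_map (tau 1) v"
  shows "trans_mat a b e *v v = c ^ cubord *s v"
proof -
  have "trans_mat a b i *v v = c ^ geo i *s vec_map (tau i) v" for i
  proof (induction i)
    case 0
    then show ?case by (simp add: geo_simps vec_map_tau_0)
  next
    case (Suc i)
    have "trans_mat a b (Suc i) *v v = c ^ geo i *s vec_map (tau i) (companion a b *v v)"
      unfolding trans_mat_Suc
      by (simp add: Suc matrix_mult_scale mat_map_vec_map[OF ring_endo_tau] flip: matrix_vector_mul_assoc)
    also have "\<dots> = c ^ geo (Suc i) *s vec_map (tau (Suc i)) v"
      by (simp add: assms vec_map_scale[OF ring_endo_tau] vec_map_vec_map tau_tau geo_simps power_add tau_def[of i c])
    finally show ?case .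
  qed
  from this[of e] show ?thesis by (simp add: geo_e vec_map_tau_0)
qed

text \<open>
  Galois descent: \<open>S\<close> is semilinear and \<open>S ^ e\<close> fixes the eigenvectors of the iterated matrix, so traces
  over the powers of \<open>S\<close> are fixed by \<open>S\<close>, and some trace is nonzero by a degree count.
\<close>

lemma eigen_imp_semilinear:
  assumes a: "a \<noteq> 0" and v: "v \<noteq> 0" and T: "trans_mat a b e *v v = c ^ cubord *s v"
  obtains w where "w \<noteq> 0" "companion a b *v w = c *s vec_map (tau 1) w"
proof -
  have "det (companion a b) \<noteq> 0" using a by (simp add: det_companion)
  then obtain D where D: "companion a b ** D = mat 1"
    by (metis invertible_det_nz invertible_def)
  \<comment> \<open>Fixed points of \<open>S\<close> are exactly the solutions sought, since
    \<open>D\<close> inverts the companion matrix.\<close>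
  define S where "S x = c *s (D *v vec_map (tau 1) x)" for x
  have CS: "companion a b *v S x = c *s vec_map (tau 1) x" for x
    by (simp add: S_def matrix_mult_scale matrix_vector_mul_assoc D)
  have S_add: "S (x + y) = S x + S y" for x y
    by (simp add: S_def vec_map_add[OF ring_endo_tau] matrix_vector_right_distrib vector_add_ldistrib)
  have S_0: "S 0 = 0" using S_add[of 0 0] by simp
  have S_scale: "S (l *s x) = l ^ 4 *s S x" for l x
    by (simp add: S_def vec_map_scale[OF ring_endo_tau] matrix_mult_scale tau_1 mult.commute)
  have S_sum: "S (\<Sum>i\<in>I. f i) = (\<Sum>i\<in>I. S (f i))" for f and I :: "nat set"
    by (induction I rule: infinite_finite_induct) (simp_all add: S_add S_0)
  have TS: "trans_mat a b i *v (S ^^ i) x = c ^ geo i *s vec_map (tau i) x" for i x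
  proof (induction i)
    case 0
    then show ?case by (simp add: geo_simps vec_map_tau_0)
  next
    case (Suc i)
    have "trans_mat a b (Suc i) *v (S ^^ Suc i) x =
        mat_map (tau 1) (trans_mat a b i) *v (c *s vec_map (tau 1) ((S ^^ i) x))"
      by (simp add: CS flip: matrix_vector_mul_assoc)
    also have "\<dots> = c *s vec_map (tau 1) (trans_mat a b i *v (S ^^ i) x)"
      by (simp only: matrix_mult_scale mat_map_vec_map[OF ring_endo_tau])
    also have "\<dots> = c ^ geo (Suc i) *s vec_map (tau (Suc i)) x"
      by (simp add: Suc vec_map_scale[OF ring_endo_tau] vec_map_vec_map tau_tau geo_simps(3) tau_1
          mult.commute flip: power_mult)
    finally show ?case .
  qed
  have inj: "x = y" if "trans_mat a b e *v x = trans_mat a b e *v y" for x y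
  proof -
    have "det (trans_mat a b e) \<noteq> 0" using a by (simp add: det_trans_mat)
    moreover have "trans_mat a b e *v (x - y) = 0"
      using that by (simp add: matrix_vector_mult_diff_distrib)
    ultimately show ?thesis using det_eq_0_iff_kernel by (metis eq_iff_diff_eq_0)
  qed
  have Se: "(S ^^ e) (l *s v) = l *s v" for l
    by (rule inj) (simp add: TS geo_e vec_map_tau_0 matrix_mult_scale T mult.commute)
  have S_pow: "(S ^^ i) (l *s v) = l ^ 4 ^ i *s (S ^^ i) v" for i l
    by (induction i) (simp_all add: S_scale mult.commute flip: power_mult)
  define w where "w l = (\<Sum>i<e. (S ^^ i) (l *s v))" for l
  have Sw: "S (w l) = w l" for l
  proof -
    have "S (w l) + l *s v = (\<Sum>i<Suc e. (S ^^ i) (l *s v))"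
      by (subst sum.lessThan_Suc_shift) (simp add: w_def S_sum add.commute)
    also have "\<dots> = w l + l *s v" by (simp add: w_def Se)
    finally show ?thesis by simp
  qed
  have "\<exists>l. w l \<noteq> 0"
  proof (rule ccontr)
    assume "\<not> ?thesis"
    then have w0: "w l = 0" for l by simp
    have "v $ j = 0" for j
    proof -
      \<comment> \<open>As a polynomial in \<open>l\<close>, coordinate \<open>j\<close> of
        \<open>w l\<close> has degree at most \<open>4 ^ (e - 1)\<close> and linear coefficient
        \<open>v $ j\<close>.\<close>
      define p where "p = (\<Sum>i<e. monom ((S ^^ i) v $ j) (4 ^ i))"
      have root: "poly p l = 0" for l
        using w0[of l] by (simp add: p_def poly_sum poly_monom w_def S_pow vec_eq_iff sum_component mult.commute)
      have "degree p \<le> 4 ^ (e - 1)"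
        unfolding p_def
        by (intro degree_sum_le order.trans[OF degree_monom_le]) auto
      also have "\<dots> < (4::nat) ^ e" using e_pos by (intro power_strict_increasing) auto
      finally have "degree p < card {x. poly p x = 0}" using root by (simp add: card_F q_sq_eq(2))
      then have "p = 0" using card_poly_roots_bound[of p] by (meson not_le)
      moreover have "coeff p 1 = (\<Sum>i<e. if i = 0 then v $ j else 0)"
        unfolding p_def coeff_sum by (rule sum.cong) auto
      ultimately show ?thesis using e_pos by simp
    qed
    then show False using v by (simp add: vec_eq_iff)
  qed
  then obtain l where "w l \<noteq> 0" ..
  then show thesis using that[of "w l"] CS[of "w l"] Sw by simp
qed

end

section \<open>Parity of the number of trivial radicals\<close>

context quadratic_extension
begin

text \<open>The exponents 1, 5, 21 of \<open>c\<close> are those produced by iterating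
  \<open>u\<close> to \<open>c * u ^ 4\<close>. So the radicals for all \<open>c\<close> are
  governed by one companion matrix, with \<open>c\<close> entering only as a scalar.\<close>

lemma radical_twist:
  assumes "c \<in> K"
  shows "(a * c ^ 3) ^ 8 * u ^ 64 + ((c * b) ^ q) ^ 8 * u ^ 16 + (c * b) ^ 4 * u ^ 4 + a * c ^ 3 * u =
    c ^ 3 * (a ^ 8 * (c ^ 21 * u ^ 64) +
      ((b ^ q) ^ 8 * (c ^ 5 * u ^ 16) + b ^ 4 * (c * u ^ 4) + a * u))"
proof -
  have "c ^ q = c" using assms K_iff by simp
  moreover have "(c ^ 3) ^ 8 = c ^ 3 * c ^ 21" "c ^ 8 = c ^ 3 * c ^ 5" "c ^ 4 = c ^ 3 * c"
    by (simp_all flip: power_mult power_add power_Suc2)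
  ultimately show ?thesis
    by (simp only: power_mult_distrib distrib_left) (simp only: mult_ac add_ac)
qed

lemma radical_imp_semilinear:
  assumes a: "a \<noteq> 0" and c: "c \<in> K" "c \<noteq> 0" and u: "u \<in> radical (a * c ^ 3) (c * b)"
  shows "companion a b *v vector [u, c * u ^ 4, c ^ 5 * u ^ 16] =
    c *s vec_map (tau 1) (vector [u, c * u ^ 4, c ^ 5 * u ^ 16])"
proof -
  have "c ^ 3 * (a ^ 8 * (c ^ 21 * u ^ 64) +
      ((b ^ q) ^ 8 * (c ^ 5 * u ^ 16) + b ^ 4 * (c * u ^ 4) + a * u)) = 0"
    using u unfolding radical_def mem_Collect_eq radical_twist[OF c(1)] .
  then have "a ^ 8 * (c ^ 21 * u ^ 64) = (b ^ q) ^ 8 * (c ^ 5 * u ^ 16) + b ^ 4 * (c * u ^ 4) + a * u"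
    using c(2) by (simp add: add_eq_0_iff_eq)
  then have "(a * u + b ^ 4 * (c * u ^ 4) + (b ^ q) ^ 8 * (c ^ 5 * u ^ 16)) / a ^ 8 = c ^ 21 * u ^ 64"
    using a by (simp add: field_simps)
  moreover have "c * (c ^ 5 * u ^ 16) ^ 4 = c ^ 21 * u ^ 64" "c * (c * u ^ 4) ^ 4 = c ^ 5 * u ^ 16"
    by (simp_all add: power_mult_distrib flip: power_mult power_Suc mult.assoc)
  ultimately show ?thesis
    by (simp add: companion_mult vec_eq_iff forall_3 vec_map_def tau_1)
qed

lemma semilinear_imp_radical:
  assumes a: "a \<noteq> 0" and c: "c \<in> K" "c \<noteq> 0" and w: "companion a b *v w = c *s vec_map (tau 1) w"
  shows "w $ 1 \<in> radical (a * c ^ 3) (c * b)" "w $ 2 = c * (w $ 1) ^ 4" "w $ 3 = c ^ 5 * (w $ 1) ^ 16"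
proof -
  define u where "u = w $ 1"
  have "(companion a b *v w) $ i = c * (w $ i) ^ 4" for i
    by (simp add: w vec_map_def tau_1)
  from this[of 1] this[of 2] this[of 3]
  have eqs: "w $ 2 = c * u ^ 4" "w $ 3 = c * (w $ 2) ^ 4"
    "(a * u + b ^ 4 * w $ 2 + (b ^ q) ^ 8 * w $ 3) / a ^ 8 = c * (w $ 3) ^ 4"
    unfolding companion_mult vector_3 u_def .
  have c4: "c * (c ^ 5 * u ^ 16) ^ 4 = c ^ 21 * u ^ 64" "c * (c * u ^ 4) ^ 4 = c ^ 5 * u ^ 16"
    by (simp_all add: power_mult_distrib flip: power_mult power_Suc mult.assoc)
  have w2: "w $ 2 = c * u ^ 4" and w3: "w $ 3 = c ^ 5 * u ^ 16"
    using eqs c4 by simp_all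
  have "a * u + b ^ 4 * (c * u ^ 4) + (b ^ q) ^ 8 * (c ^ 5 * u ^ 16) = a ^ 8 * (c ^ 21 * u ^ 64)"
    using eqs(3) a unfolding w2 w3 c4 by (simp add: field_simps)
  then have "a ^ 8 * (c ^ 21 * u ^ 64) +
      ((b ^ q) ^ 8 * (c ^ 5 * u ^ 16) + b ^ 4 * (c * u ^ 4) + a * u) = 0"
    by (simp add: add_eq_0_iff_eq add_ac)
  then show "w $ 1 \<in> radical (a * c ^ 3) (c * b)"
    unfolding radical_def mem_Collect_eq radical_twist[OF c(1)] u_def by (simp only: mult_zero_right)
  show "w $ 2 = c * (w $ 1) ^ 4" "w $ 3 = c ^ 5 * (w $ 1) ^ 16"
    using w2 w3 by (simp_all add: u_def)
qed

definition charpol :: "'a \<Rightarrow> 'a \<Rightarrow> 'a \<Rightarrow> 'a" where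
  "charpol a b z = det (trans_mat a b e + mat z)"

lemma eigen_iff: "(A + mat z) *v v = 0 \<longleftrightarrow> A *v v = z *s (v :: 'a ^ 3)"
  by (simp add: matrix_vector_mult_add_rdistrib mat_vector vec_eq_iff add_eq_0_iff_eq)

lemma radical_trivial_iff:
  assumes a: "a \<noteq> 0" and c: "c \<in> K" "c \<noteq> 0"
  shows "radical (a * c ^ 3) (c * b) = {0} \<longleftrightarrow> charpol a b (c ^ cubord) \<noteq> 0"
proof -
  have "radical (a * c ^ 3) (c * b) \<noteq> {0} \<longleftrightarrow> charpol a b (c ^ cubord) = 0"
  proof
    assume "radical (a * c ^ 3) (c * b) \<noteq> {0}"
    then obtain u where u: "u \<in> radical (a * c ^ 3) (c * b)" "u \<noteq> 0"
      using zero_radical by blast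
    define v :: "'a ^ 3" where "v = vector [u, c * u ^ 4, c ^ 5 * u ^ 16]"
    have "v \<noteq> 0" using u by (simp add: v_def vec_eq_iff forall_3)
    moreover have "trans_mat a b e *v v = c ^ cubord *s v"
      unfolding v_def by (rule semilinear_imp_eigen[OF radical_imp_semilinear[OF a c u(1)]])
    ultimately show "charpol a b (c ^ cubord) = 0"
      unfolding charpol_def det_eq_0_iff_kernel eigen_iff by blast
  next
    assume "charpol a b (c ^ cubord) = 0"
    then obtain v where "v \<noteq> 0" "trans_mat a b e *v v = c ^ cubord *s v"
      unfolding charpol_def det_eq_0_iff_kernel eigen_iff by blast
    then obtain w where w: "w \<noteq> 0" "companion a b *v w = c *s vec_map (tau 1) w"
      by (rule eigen_imp_semilinear[OF a])
    note r = semilinear_imp_radical[OF a c w(2)]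
    have "w $ 1 \<noteq> 0" using r(2,3) w(1) by (auto simp: vec_eq_iff forall_3)
    then show "radical (a * c ^ 3) (c * b) \<noteq> {0}" using r(1) by auto
  qed
  then show ?thesis by blast
qed

text \<open>Expanding \<open>trans_mat a b (Suc e)\<close> from either end shows that the companion
  matrix conjugates the iterated matrix into its entrywise fourth power. As
  \<open>z ^ 4 = z\<close>, the determinant is its own fourth power.\<close>

lemma charpol_power4:
  assumes a: "a \<noteq> 0" and z: "z ^ 3 = 1"
  shows "charpol a b z ^ 4 = charpol a b z"
proof -
  let ?T = "trans_mat a b e" and ?C = "companion a b"
  have "mat_map (tau 1) ?T ** ?C = ?C ** ?T"
    using trans_mat_Suc[of a b e] by (simp add: mat_map_tau_0)
  moreover have z4: "z ^ 4 = z" using z by (simp add: power4_eq_xxxx power3_eq_cube mult.assoc)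
  ultimately have "mat_map (tau 1) (?T + mat z) ** ?C = ?C ** (?T + mat z)"
    by (simp add: mat_map_add[OF ring_endo_tau] mat_map_mat[OF ring_endo_tau] tau_1 mat_commute
        matrix_add_ldistrib matrix_mult_add_rdistrib)
  then have "det (mat_map (tau 1) (?T + mat z)) * det ?C = det ?C * det (?T + mat z)"
    by (metis det_mul)
  then show ?thesis
    using a by (simp add: det_mat_map[OF ring_endo_tau] tau_1 charpol_def det_companion mult.commute)
qed

text \<open>
  The Gram matrix (shifted by \<open>\<psi>\<^sup>2\<close>) of the Hermitian form that sends solutions \<open>u\<close>, \<open>w\<close> of the radical
  equation to \<open>a w \<psi>\<^sup>3 u + \<psi>\<inverse>(a u \<psi>\<^sup>3 w) + \<psi>\<inverse>\<psi>\<inverse>(a w \<psi>\<^sup>3 u) + b w \<psi> u\<close>. It arises by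
  multiplying the equation of \<open>u\<close> by \<open>w\<close> and telescoping, and has values in the field with four elements.
\<close>

definition herm :: "'a \<Rightarrow> 'a \<Rightarrow> 'a ^ 3 ^ 3" where
  "herm a b = vector [vector [0, a, 0], vector [0, b ^ 4, a ^ 4], vector [a\<^sup>2, 0, 0]]"

lemma det_herm: "a \<noteq> 0 \<Longrightarrow> det (herm a b) \<noteq> 0"
  by (simp add: herm_def det_3)

text \<open>One step of the semilinear system preserves the form. Here \<open>psi\<close> sends
  \<open>a\<close> to \<open>a\<^sup>2\<close>, \<open>b ^ 4\<close> to \<open>(b ^ q) ^ 8\<close>
  and \<open>(b ^ q) ^ 8\<close> to \<open>b ^ 16\<close>.\<close>

lemma companion_herm:
  assumes a: "a ^ q = a" "a \<noteq> 0"
  shows "transpose (companion a b) ** mat_map (tau 1) (herm a b) ** mat_map psi (companion a b) = herm a b"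
proof -
  have psi_divide: "psi (x / y) = psi x / psi y" for x y
    by (simp add: psi_def power_divide)
  have psi_a: "psi a = a\<^sup>2" by (simp add: psi_def a)
  have p: "(a ^ 4) ^ 4 = a ^ 16" "(a\<^sup>2) ^ 8 = a ^ 16" "(b ^ 4) ^ 4 = b ^ 16" "(a\<^sup>2) ^ 4 = a ^ 8"
    by (simp_all flip: power_mult)
  have "(x\<^sup>2) ^ 4 = x ^ 8" "(x\<^sup>2) ^ 8 = x ^ 16" for x :: 'a
    by (simp_all flip: power_mult)
  then have psi_b: "psi b ^ 4 = (b ^ q) ^ 8" "(psi b ^ q) ^ 8 = b ^ 16"
    unfolding psi_power[of b q, symmetric] unfolding psi_def power_q_q by blast+
  show ?thesis
    using a(2)
    by (simp add: companion_def herm_def vec_eq_iff forall_3 matrix_matrix_mult_def sum_3 transpose_def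
        mat_map_def tau_1 psi_divide psi_power psi_a psi_b p two_eq_0)
qed

lemma trans_mat_herm:
  assumes a: "a ^ q = a" "a \<noteq> 0"
  shows "transpose (trans_mat a b i) ** mat_map (tau i) (herm a b) ** mat_map psi (trans_mat a b i) =
    herm a b"
proof (induction i)
  case 0
  then show ?case by (simp add: mat_map_tau_0 mat_map_mat[OF ring_endo_psi])
next
  case (Suc i)
  let ?T = "trans_mat a b i" and ?C = "companion a b" and ?J = "herm a b"
  have "mat_map psi (mat_map (tau i) ?C) = mat_map (tau i) (mat_map psi ?C)"
    by (simp add: mat_map_mat_map tau_def psi_power)
  moreover have "mat_map (tau (Suc i)) ?J = mat_map (tau i) (mat_map (tau 1) ?J)"
    by (simp add: mat_map_mat_map tau_tau)
  ultimately have "transpose (trans_mat a b (Suc i)) ** mat_map (tau (Suc i)) ?J **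
      mat_map psi (trans_mat a b (Suc i)) =
    transpose ?T ** mat_map (tau i) (transpose ?C ** mat_map (tau 1) ?J ** mat_map psi ?C) **
      mat_map psi ?T"
    unfolding trans_mat_Suc
    by (simp only: matrix_transpose_mul transpose_mat_map mat_map_mult[OF ring_endo_psi]
        mat_map_mult[OF ring_endo_tau] matrix_mul_assoc)
  then show ?case by (simp only: companion_herm[OF a] Suc)
qed

text \<open>Write T for the iterated matrix, J for the form and P for the determinant of T + z.
  Unitarity gives det T * \<psi>(P) = P. As \<open>P ^ 4 = P\<close>, a nonzero P is a cube root of
  unity, so \<psi>(P) = P^2 and det T * P = 1.\<close>

lemma charpol_cases:
  assumes a: "a ^ q = a" "a \<noteq> 0" and z: "z ^ 3 = 1"
  shows "charpol a b z = 0 \<or> charpol a b z * det (trans_mat a b e) = 1"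
proof -
  let ?T = "trans_mat a b e" and ?J = "herm a b"
  define P where "P = charpol a b z"
  have zq: "z ^ q = z" using z by (rule power_1_mod_3)
  have z3: "z\<^sup>2 * z = 1" using z by (simp add: power3_eq_cube power2_eq_square)
  have "transpose ?T ** ?J ** mat_map psi (?T + mat z) = ?J + transpose ?T ** (?J ** mat (z\<^sup>2))"
    using trans_mat_herm[OF a, of b e]
    by (simp add: mat_map_add[OF ring_endo_psi] mat_map_mat[OF ring_endo_psi] matrix_add_ldistrib
        mat_map_tau_0 psi_def[of z] zq matrix_mul_assoc)
  \<comment> \<open>Since \<open>psi z = z\<^sup>2\<close> and \<open>z\<^sup>2 * z = 1\<close>, the
    term \<open>?J\<close> absorbs a scalar and the factor \<open>?T + mat z\<close> reappears,
    transposed, on the left.\<close>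
  also have "\<dots> = mat (z\<^sup>2) ** transpose (?T + mat z) ** ?J"
  proof -
    have tr: "transpose (?T + mat z) = transpose ?T + mat z"
      by (simp add: transpose_def mat_def vec_eq_iff eq_commute)
    have "mat (z\<^sup>2) ** (transpose ?T + mat z) ** ?J =
        mat (z\<^sup>2) ** transpose ?T ** ?J + mat (z\<^sup>2 * z) ** ?J"
      by (simp only: matrix_add_ldistrib matrix_mult_add_rdistrib mat_mat_mult)
    also have "\<dots> = transpose ?T ** (?J ** mat (z\<^sup>2)) + ?J"
      unfolding z3 by (simp only: mat_commute matrix_mul_assoc matrix_mul_lid)
    finally show ?thesis unfolding tr by (simp only: add.commute)
  qed
  finally have "det (transpose ?T ** ?J ** mat_map psi (?T + mat z)) =
      det (mat (z\<^sup>2) ** transpose (?T + mat z) ** ?J)"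
    by (rule arg_cong)
  then have "det ?T * det ?J * det (mat_map psi (?T + mat z)) = (z\<^sup>2) ^ 3 * P * det ?J"
    by (simp only: det_mul det_transpose det_mat P_def charpol_def)
  moreover have "(z\<^sup>2) ^ 3 = 1" using z by (metis power_mult mult.commute power_one)
  ultimately have 1: "det ?T * psi P = P"
    using det_herm[OF a(2)] by (simp add: det_mat_map[OF ring_endo_psi] P_def charpol_def)
  have P4: "P ^ 4 = P" unfolding P_def using charpol_power4 a z by blast
  show ?thesis
  proof (cases "P = 0")
    case False
    have "P * P ^ 3 = P * 1" using P4 by (simp flip: power_Suc)
    then have "P ^ 3 = 1" using False by simp
    then have "P ^ q = P" by (rule power_1_mod_3)
    then have "(det ?T * P) * P = 1 * P" using 1 by (simp add: psi_def power2_eq_square mult.assoc)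
    then show ?thesis using False by (simp add: P_def mult.commute)
  qed (simp add: P_def)
qed

end

context quadratic_extension_noncube
begin

text \<open>\<open>charpol\<close> is a monic cubic in \<open>z\<close> with constant term the
  determinant. Summing over the cube roots of unity kills its linear and quadratic terms, and the
  remaining factor 3 is 1.\<close>

lemma sum_charpol: "charpol a b 1 + charpol a b \<omega> + charpol a b (\<omega>\<^sup>2) = 1 + det (trans_mat a b e)"
proof -
  have w: "\<omega> * \<omega> = \<omega> + 1" using \<omega>_sq by (simp add: power2_eq_square)
  have w': "\<omega> * (\<omega> * x) = \<omega> * x + x" for x
    by (metis w mult.assoc distrib_right mult_1)
  show ?thesis
    unfolding charpol_def det_3 \<omega>_sq diff_eq_add
    by (simp add: mat_def algebra_simps w w')
qed

text \<open>Every nonzero value of \<open>charpol\<close> equals \<open>x = a ^ cubord\<close>, and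
  the determinant \<open>d\<close> is the inverse of \<open>x\<close>. The three values add up to
  \<open>1 + d\<close>, which is zero iff \<open>x = 1\<close>; in characteristic two this gives the
  parity of the number of nonzero values.\<close>

lemma even_nontrivial_radicals:
  assumes a: "a \<in> K" "a \<noteq> 0"
  shows "even (card {c \<in> reps. radical (a * c ^ 3) (c * b) = {0}}) \<longleftrightarrow> a ^ cubord = 1"
proof -
  define d where "d = det (trans_mat a b e)"
  have aq: "a ^ q = a" using a K_iff by simp
  define x where "x = a ^ cubord"
  have x3: "x ^ 3 = 1" unfolding x_def using cubord_cube[OF a(2)] by (simp add: mult.commute flip: power_mult)
  have x0: "x \<noteq> 0" using a by (simp add: x_def)
  have "x ^ 8 = x\<^sup>2"
  proof -
    have "x ^ 8 = (x ^ 3) ^ 2 * x\<^sup>2" by (simp flip: power_mult power_add)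
    then show ?thesis using x3 by simp
  qed
  then have "d = x / x\<^sup>2"
    by (simp add: d_def det_trans_mat x_def power_divide power_commuting_commutes mult.commute flip: power_mult)
  then have d: "d * x = 1" using x0 by (simp add: power2_eq_square)
  have d3: "d ^ 3 = 1" using d x3 by (metis power_mult_distrib power_one mult_1_right)
  let ?P = "\<lambda>c. charpol a b (c ^ cubord)"
  have cases: "?P c = 0 \<or> ?P c = x" if "c \<in> reps" for c
  proof -
    have "(c ^ cubord) ^ 3 = 1"
      using cubord_cube[OF reps_nonzero[OF that]] by (simp add: mult.commute flip: power_mult)
    then have "?P c = 0 \<or> ?P c * d = 1" using charpol_cases[OF aq a(2)] by (auto simp: d_def)
    then show ?thesis using d by (metis mult.assoc mult.commute mult_1)
  qed
  have sum: "?P 1 + ?P g + ?P (g\<^sup>2) = 1 + d"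
    unfolding reps_cubord using sum_charpol by (simp add: d_def)
  have set: "{c \<in> reps. radical (a * c ^ 3) (c * b) = {0}} = {c \<in> reps. ?P c \<noteq> 0}"
    using radical_trivial_iff[OF a(2)] reps_K reps_nonzero by auto
  have "card {c \<in> reps. ?P c \<noteq> 0} = (\<Sum>c\<in>reps. of_bool (?P c \<noteq> 0))"
    by (simp add: sum.If_cases of_bool_def Int_def)
  also have "\<dots> = of_bool (?P 1 \<noteq> 0) + of_bool (?P g \<noteq> 0) + of_bool (?P (g\<^sup>2) \<noteq> 0)"
    by (rule sum_reps)
  finally have card: "card {c \<in> reps. ?P c \<noteq> 0} =
    of_bool (?P 1 \<noteq> 0) + of_bool (?P g \<noteq> 0) + of_bool (?P (g\<^sup>2) \<noteq> 0)" .
  have c3: "?P 1 = 0 \<or> ?P 1 = x" "?P g = 0 \<or> ?P g = x" "?P (g\<^sup>2) = 0 \<or> ?P (g\<^sup>2) = x"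
    by (rule cases, simp add: reps_def)+
  have "1 + d = 0 \<longleftrightarrow> x = 1"
    using d by (auto simp: add_eq_0_iff_eq)
  then show ?thesis
    unfolding set card x_def[symmetric]
    using c3 sum x0 by auto
qed

end

section \<open>Walsh values as sums over quadratic forms\<close>

text \<open>The vectors are the columns of a 4 by 4 matrix whose fourth row repeats the first, so
  its determinant vanishes and it has a kernel vector.\<close>

lemma four_vectors_dependent:
  fixes v1 v2 v3 v4 :: "'a::field ^ 3"
  obtains x y z t where "x *s v1 + y *s v2 + z *s v3 + t *s v4 = 0" "x \<noteq> 0 \<or> y \<noteq> 0 \<or> z \<noteq> 0 \<or> t \<noteq> 0"
proof -
  define cols :: "'a ^ 3 ^ 4" where
    "cols = (\<chi> i. if i = 1 then v1 else if i = 2 then v2 else if i = 3 then v3 else v4)"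
  define rows :: "3 ^ 4" where "rows = (\<chi> i. if i = 2 then 2 else if i = 3 then 3 else 1)"
  define N :: "'a ^ 4 ^ 4" where "N = (\<chi> i j. cols $ j $ (rows $ i))"
  have "row 1 N = row 4 N" by (simp add: row_def N_def rows_def)
  then have "det N = 0" by (rule det_identical_rows[rotated]) simp
  then obtain x where x: "x \<noteq> 0" "N *v x = 0" unfolding det_eq_0_iff_kernel by blast
  have "(N *v x) $ i = 0" for i using x by simp
  from this[of 1] this[of 2] this[of 3]
  have "x $ 1 *s v1 + x $ 2 *s v2 + x $ 3 *s v3 + x $ 4 *s v4 = 0"
    by (simp add: vec_eq_iff forall_3 matrix_vector_mult_def sum_4 N_def rows_def cols_def mult.commute)
  moreover have "x $ 1 \<noteq> 0 \<or> x $ 2 \<noteq> 0 \<or> x $ 3 \<noteq> 0 \<or> x $ 4 \<noteq> 0"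
    using x(1) by (auto simp: vec_eq_iff forall_4)
  ultimately show thesis by (rule that)
qed

text \<open>Applying (T - \<beta>)(T - \<gamma>) to the vanishing sum kills \<open>r\<close> and
  \<open>s\<close> and multiplies \<open>p\<close> by a nonzero scalar.\<close>

lemma eigen_sum_zero:
  fixes p r s :: "'a::field ^ 'n"
  assumes T: "T *v p = \<alpha> *s p" "T *v r = \<beta> *s r" "T *v s = \<gamma> *s s"
    and sum: "p + r + s = 0" and distinct: "\<alpha> \<noteq> \<beta>" "\<alpha> \<noteq> \<gamma>"
  shows "p = 0"
proof -
  have 1: "\<alpha> *s p + \<beta> *s r + \<gamma> *s s = 0"
    using arg_cong[OF sum, of "\<lambda>x. T *v x"] by (simp add: matrix_vector_right_distrib T)
  have 2: "\<alpha> *s (\<alpha> *s p) + \<beta> *s (\<beta> *s r) + \<gamma> *s (\<gamma> *s s) = 0"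
    using arg_cong[OF 1, of "\<lambda>x. T *v x"]
    by (simp add: matrix_vector_right_distrib matrix_mult_scale T)
  have "p $ j = 0" for j
  proof -
    have "(\<alpha> - \<beta>) * (\<alpha> - \<gamma>) * p $ j =
      (\<alpha> *s (\<alpha> *s p) + \<beta> *s (\<beta> *s r) + \<gamma> *s (\<gamma> *s s)) $ j -
      (\<beta> + \<gamma>) * (\<alpha> *s p + \<beta> *s r + \<gamma> *s s) $ j + \<beta> * \<gamma> * (p + r + s) $ j"
      by (simp add: algebra_simps)
    also have "\<dots> = 0" unfolding 1 2 sum by simp
    finally show ?thesis using distinct by simp
  qed
  then show ?thesis by (simp add: vec_eq_iff)
qed

context quadratic_extension_noncube
begin

lemma card_reps_filter:
  "card {c \<in> reps. p c} = of_bool (p 1) + of_bool (p g) + of_bool (p (g\<^sup>2))"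
proof -
  have "card {c \<in> reps. p c} = (\<Sum>c\<in>reps. of_bool (p c))"
    by (simp add: sum.If_cases of_bool_def Int_def)
  then show ?thesis by (simp only: sum_reps)
qed

lemma radical_eigenvector:
  assumes a: "a \<noteq> 0" and c: "c \<in> reps" and u: "u \<in> radical (a * c ^ 3) (c * b)"
  shows "trans_mat a b e *v vector [u, c * u ^ 4, c ^ 5 * u ^ 16] =
    c ^ cubord *s vector [u, c * u ^ 4, c ^ 5 * u ^ 16]"
  by (rule semilinear_imp_eigen[OF radical_imp_semilinear[OF a reps_K[OF c] reps_nonzero[OF c] u]])

text \<open>
  If all three radicals are nontrivial, the iterated matrix has three distinct eigenvalues, hence
  one-dimensional eigenspaces.
\<close>

lemma card_radical_le_4:
  assumes a: "a \<noteq> 0" and nontriv: "\<And>c. c \<in> reps \<Longrightarrow> radical (a * c ^ 3) (c * b) \<noteq> {0}"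
    and c: "c \<in> reps"
  shows "card (radical (a * c ^ 3) (c * b)) \<le> 4"
proof -
  let ?R = "\<lambda>c. radical (a * c ^ 3) (c * b)"
  let ?T = "trans_mat a b e"
  define v :: "'a \<Rightarrow> 'a \<Rightarrow> 'a ^ 3" where "v c u = vector [u, c * u ^ 4, c ^ 5 * u ^ 16]" for c u
  have eig: "?T *v v c u = c ^ cubord *s v c u" if "c \<in> reps" "u \<in> ?R c" for c u
    unfolding v_def using that by (rule radical_eigenvector[OF a])
  have v0: "v c u \<noteq> 0" if "u \<noteq> 0" for c u
    using that by (simp add: v_def vec_eq_iff forall_3)
  obtain u where u: "u \<in> ?R c" "u \<noteq> 0"
    using nontriv[OF c] zero_radical by blast
  have "\<exists>c1\<in>reps. \<exists>c2\<in>reps. c \<noteq> c1 \<and> c \<noteq> c2 \<and> c1 \<noteq> c2"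
  proof -
    have "card (reps - {c}) = 2" using c by (simp add: card_reps)
    then obtain c1 c2 where "reps - {c} = {c1, c2}" "c1 \<noteq> c2" by (auto simp: card_2_iff)
    then show ?thesis by blast
  qed
  then obtain c1 c2 where c12: "c1 \<in> reps" "c2 \<in> reps" "c \<noteq> c1" "c \<noteq> c2" "c1 \<noteq> c2" by blast
  then have z: "c ^ cubord \<noteq> c1 ^ cubord" "c ^ cubord \<noteq> c2 ^ cubord" "c1 ^ cubord \<noteq> c2 ^ cubord"
    using c inj_reps by (auto dest: inj_onD)
  obtain u1 where u1: "u1 \<in> ?R c1" "u1 \<noteq> 0" using nontriv[OF c12(1)] zero_radical by blast
  obtain u2 where u2: "u2 \<in> ?R c2" "u2 \<noteq> 0" using nontriv[OF c12(2)] zero_radical by blast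
  have multiple: "w \<in> (\<lambda>m. m * u) ` {0, 1, \<omega>, \<omega>\<^sup>2}" if w: "w \<in> ?R c" for w
  proof (cases "w = 0")
    case False
    \<comment> \<open>Two vectors for the class \<open>c\<close> and one for each other class live
      in a space of dimension three; separating eigenvalues leaves a relation between the first
      two.\<close>
    obtain x y s t where rel: "x *s v c u + y *s v c w + s *s v c1 u1 + t *s v c2 u2 = 0"
      and nz: "x \<noteq> 0 \<or> y \<noteq> 0 \<or> s \<noteq> 0 \<or> t \<noteq> 0"
      by (rule four_vectors_dependent)
    define p where "p = x *s v c u + y *s v c w"
    have Tp: "?T *v p = c ^ cubord *s p"
      unfolding p_def matrix_vector_right_distrib matrix_mult_scale eig[OF c u(1)] eig[OF c w]
      by (simp add: vec_eq_iff algebra_simps)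
    have T1: "?T *v (s *s v c1 u1) = c1 ^ cubord *s (s *s v c1 u1)"
      unfolding matrix_mult_scale eig[OF c12(1) u1(1)] by (simp add: mult.commute)
    have T2: "?T *v (t *s v c2 u2) = c2 ^ cubord *s (t *s v c2 u2)"
      unfolding matrix_mult_scale eig[OF c12(2) u2(1)] by (simp add: mult.commute)
    have "p = 0"
      by (rule eigen_sum_zero[OF Tp T1 T2]) (use rel z in \<open>simp_all add: p_def\<close>)
    moreover have "s *s v c1 u1 = 0"
      by (rule eigen_sum_zero[OF T1 Tp T2]) (use rel z in \<open>simp_all add: p_def add_ac\<close>)
    moreover have "t *s v c2 u2 = 0"
      by (rule eigen_sum_zero[OF T2 Tp T1]) (use rel z in \<open>simp_all add: p_def add_ac\<close>)
    ultimately have p0: "x *s v c u + y *s v c w = 0" and xy: "x \<noteq> 0 \<or> y \<noteq> 0"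
      using nz v0 u1 u2 by (auto simp: p_def)
    have comps: "x * u + y * w = 0" "x * (c * u ^ 4) + y * (c * w ^ 4) = 0"
      using p0 by (simp_all add: v_def vec_eq_iff forall_3)
    have y: "y \<noteq> 0" using comps(1) xy u(2) by auto
    define m where "m = x / y"
    have w_eq: "w = m * u" using comps(1) y by (simp add: m_def add_eq_0_iff_eq field_simps)
    have "c * (x * u ^ 4) = c * (y * w ^ 4)" using comps(2) by (simp add: add_eq_0_iff_eq mult_ac)
    then have "w ^ 4 = m * u ^ 4"
      \<comment> \<open>The first coordinate gives \<open>w = m * u\<close> and the second
        \<open>w ^ 4 = m * u ^ 4\<close>, so \<open>m ^ 4 = m\<close>.\<close>
      using y reps_nonzero[OF c] by (simp add: m_def field_simps)
    then have "m ^ 4 = m" using w_eq u(2) by (simp add: power_mult_distrib)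
    then have "m * (m ^ 3) = m * 1" by (simp flip: power_Suc)
    then have "m = 0 \<or> m ^ 3 = 1" by simp
    then have "m \<in> {0, 1, \<omega>, \<omega>\<^sup>2}" by (auto simp: cube_eq_1)
    then show ?thesis using w_eq by blast
  qed simp
  have "card (?R c) \<le> card ((\<lambda>m. m * u) ` {0, 1, \<omega>, \<omega>\<^sup>2})"
    by (intro card_mono) (use multiple in auto)
  also have "\<dots> \<le> card {0, 1, \<omega>, \<omega>\<^sup>2}" by (rule card_image_le) simp
  also have "\<dots> \<le> 4" by (simp add: card_insert_if)
  finally show ?thesis .
qed

text \<open>A character that is -1 at a nonzero element \<open>u\<close> of the radical sums to 0
  over it. Adding 1 to each of its values makes them even without changing what the sum
  counts.\<close>

lemma even_card_radical:
  assumes "radical a b \<noteq> {0}"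
  shows "even (card (radical a b))"
proof -
  let ?R = "radical a b"
  obtain u where u: "u \<in> ?R" "u \<noteq> 0" using assms zero_radical by blast
  obtain z where "chi z = - 1" using ex_chi_neg by blast
  then have z: "chi (z / u * u) = - 1" using u by simp
  have "(\<Sum>w\<in>?R. chi (z / u * w)) = (\<Sum>w\<in>?R. chi (z / u * (w + u)))"
    by (rule sum.reindex_bij_witness[of _ "\<lambda>w. w + u" "\<lambda>w. w + u"])
      (use u in \<open>auto intro: radical_add simp: add.assoc\<close>)
  also have "\<dots> = - (\<Sum>w\<in>?R. chi (z / u * w))"
    unfolding distrib_left chi_add z by (simp add: sum_negf)
  finally have "(\<Sum>w\<in>?R. chi (z / u * w)) = 0" by simp
  then have "int (card ?R) = (\<Sum>w\<in>?R. 1 + chi (z / u * w))" by (simp add: sum.distrib)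
  moreover have "even (\<Sum>w\<in>?R. 1 + chi (z / u * w))"
    by (rule dvd_sum) (simp add: chi_def)
  ultimately have "even (int (card ?R))" by simp
  then show ?thesis by simp
qed

text \<open>The quotient \<open>t\<close> satisfies \<open>t\<^sup>2 = card (radical a b)\<close>,
  which is at most 64, and \<open>t mod 3 = 1\<close>; it is even when the radical is
  nontrivial.\<close>

lemma quad_sum_cases:
  assumes a: "a \<in> K" "a \<noteq> 0"
  obtains t where "quad_sum a b = int q * t" "t \<in> {1, - 2, 4, - 8}"
    "t = 1 \<longleftrightarrow> radical a b = {0}" "radical a b \<noteq> {0} \<Longrightarrow> card (radical a b) \<le> 4 \<Longrightarrow> t = - 2"
proof -
  let ?R = "radical a b"
  have sq: "(quad_sum a b)\<^sup>2 = (int q)\<^sup>2 * int (card ?R)"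
    using quad_sum_squared[of a b] a K_iff by simp
  then have "(int q)\<^sup>2 dvd (quad_sum a b)\<^sup>2" by simp
  then have "int q dvd quad_sum a b" by simp
  then obtain t where t: "quad_sum a b = int q * t" by blast
  then have t2: "t\<^sup>2 = int (card ?R)"
    using sq q_ge_4 by (simp add: power_mult_distrib)
  have "t mod 3 = 1"
  proof -
    have "quad_sum a b mod 3 = (int (q mod 3) * t) mod 3" unfolding t zmod_int by (simp add: mod_mult_left_eq)
    then show ?thesis using quad_sum_mod_3 by (simp add: q_mod_3)
  qed
  have le: "card ?R \<le> 64" using a(2) by (rule card_radical_le)
  have "t\<^sup>2 \<le> 8\<^sup>2" using t2 le by simp
  then have "\<bar>t\<bar> \<le> 8" using abs_le_square_iff[of t 8] by simp
  then have t_in: "t \<in> {- 8, - 5, - 2, 1, 4, 7}" using \<open>t mod 3 = 1\<close>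
    unfolding insert_iff empty_iff by presburger
  have triv: "?R = {0} \<longleftrightarrow> card ?R = 1"
    using zero_radical[of a b] by (auto simp: card_1_singleton_iff)
  have ev: "?R \<noteq> {0} \<Longrightarrow> even t"
    using even_card_radical[of a b] t2 by (metis even_of_nat even_power pos2 zero_less_numeral)
  show thesis
  proof (rule that[OF t])
    show "t \<in> {1, - 2, 4, - 8}"
    proof (cases "?R = {0}")
      case True
      then have "t\<^sup>2 = 1" using triv t2 by simp
      then show ?thesis using t_in by auto
    qed (use ev t_in in auto)
    show "t = 1 \<longleftrightarrow> ?R = {0}"
      using ev triv t2 t_in by auto
    show "t = - 2" if "?R \<noteq> {0}" "card ?R \<le> 4"
    proof -
      have "t\<^sup>2 \<le> 4" using t2 that by simp
      then show ?thesis using ev[OF that(1)] t_in by auto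
    qed
  qed
qed

section \<open>From Walsh values to quadratic forms\<close>

definition walsh_sum :: "'a \<Rightarrow> 'a \<Rightarrow> int" where
  "walsh_sum \<alpha> \<beta> = (\<Sum>x\<in>UNIV. chi (\<alpha> * x ^ 3 + \<beta> * sig x))"

text \<open>If \<open>s ^ q = \<omega>\<^sup>2 * s\<close>, a second \<open>q\<close>-th power gives
  \<open>s = \<omega> * s\<close>, so \<open>s = 0\<close>.\<close>

lemma bij_change: "bij (\<lambda>u. \<omega>\<^sup>2 * u + u ^ q)"
proof -
  have "inj (\<lambda>u. \<omega>\<^sup>2 * u + u ^ q)"
  proof (rule injI)
    fix x y assume "\<omega>\<^sup>2 * x + x ^ q = \<omega>\<^sup>2 * y + y ^ q"
    then have "(\<omega>\<^sup>2 * x + x ^ q) + (\<omega>\<^sup>2 * y + y ^ q) = 0" by (simp only: add_self)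
    then have "\<omega>\<^sup>2 * (x + y) + (x + y) ^ q = 0"
      by (simp add: power_add_char2 distrib_left add_ac)
    then have 1: "(x + y) ^ q = \<omega>\<^sup>2 * (x + y)" by (simp add: add_eq_0_iff_eq)
    have w2: "(\<omega>\<^sup>2) ^ q = \<omega>\<^sup>2" by (metis \<omega>_q power_mult mult.commute)
    have "x + y = ((x + y) ^ q) ^ q" by (rule power_q_q[symmetric])
    also have "\<dots> = \<omega>\<^sup>2 * (\<omega>\<^sup>2 * (x + y))"
      by (simp only: 1 power_mult_distrib w2)
    also have "\<omega>\<^sup>2 * (\<omega>\<^sup>2 * (x + y)) = \<omega> * (x + y)"
      using \<omega>_cube by (simp add: power2_eq_square power3_eq_cube flip: mult.assoc)
    finally have "x + y = 0" using \<omega>_neq_1 by (metis mult_cancel_right1)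
    then show "x = y" by (simp only: add_eq_0_iff_eq)
  qed
  then show ?thesis
    using finite_UNIV_inj_surj[of "\<lambda>u. \<omega>\<^sup>2 * u + u ^ q"] by (simp add: bij_def)
qed

text \<open>With \<open>y = \<omega>\<^sup>2 * u + v\<close> and \<open>v = u ^ q\<close>, the two
  linear factors of \<open>cnorm y\<close> become \<open>v\<close> and
  \<open>\<omega>\<^sup>2 * u\<close>, so \<open>y * cnorm y\<close> has only mixed terms. In
  \<open>y ^ 9\<close> the signs of \<open>u ^ 9\<close> and \<open>v ^ 9\<close> cancel, as
  conjugates have the same trace; the other conjugate terms are merged in the same way.\<close>

lemma cubic_sum_eq_quad_sum:
  assumes a: "a ^ q = a" and c: "c ^ q = c"
  shows "(\<Sum>y\<in>UNIV. chi (a * y ^ 9 + \<beta> * (c * (y * cnorm y)))) =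
    quad_sum a (c * (\<omega>\<^sup>2 * \<beta> + \<omega> * \<beta> ^ q))"
proof -
  have w: "\<omega> * \<omega> = \<omega> + 1" using \<omega>_sq by (simp add: power2_eq_square)
  have w': "\<omega> * (\<omega> * x) = \<omega> * x + x" for x
    by (metis w mult.assoc distrib_right mult_1)
  have "chi (a * y ^ 9 + \<beta> * (c * (y * cnorm y))) = chi (quad a (c * (\<omega>\<^sup>2 * \<beta> + \<omega> * \<beta> ^ q)) u)"
    if y: "y = \<omega>\<^sup>2 * u + u ^ q" for u y
  proof -
    define v where "v = u ^ q"
    have vq: "v ^ q = u" by (simp add: v_def)
    have yq: "y ^ q = \<omega>\<^sup>2 * v + u"
      using \<omega>_q unfolding y v_def power_add_char2 power_mult_distrib
      by (simp add: power2_eq_square power_mult_distrib)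
    have power_9: "x ^ 9 = x * x ^ 8" for x :: 'a by (simp flip: power_Suc)
    have "y ^ 8 = \<omega> * u ^ 8 + v ^ 8"
    proof -
      have "(\<omega>\<^sup>2) ^ 8 = (\<omega> ^ 3) ^ 5 * \<omega>" by (simp flip: power_mult power_Suc2)
      then show ?thesis by (simp add: y v_def power_add_char2 power_mult_distrib \<omega>_cube)
    qed
    then have "y ^ 9 = (\<omega>\<^sup>2 * u + v) * (\<omega> * u ^ 8 + v ^ 8)" by (simp add: power_9 y v_def)
    also have "\<dots> = (u ^ 9 + v ^ 9) + (\<omega> + 1) * (u * v ^ 8) + \<omega> * (u ^ 8 * v)"
      unfolding power_9 by (simp add: \<omega>_sq w w' algebra_simps)
    finally have y9: "y ^ 9 = (u ^ 9 + v ^ 9) + (\<omega> + 1) * (u * v ^ 8) + \<omega> * (u ^ 8 * v)" .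
    have yn: "y * cnorm y = (\<omega> + 1) * (u * v\<^sup>2) + \<omega> * (u\<^sup>2 * v)"
      unfolding cnorm_def yq unfolding y v_def[symmetric]
      by (simp add: \<omega>_sq w w' algebra_simps power2_eq_square two_eq_0 char2_numeral)
    have c1: "chi (a * v ^ 9) = chi (a * u ^ 9)"
    proof -
      have "(a * u ^ 9) ^ q = a * v ^ 9" by (simp add: power_mult_distrib a v_def mult.commute flip: power_mult)
      then show ?thesis by (metis chi_power(1))
    qed
    have c2: "chi (a * (\<omega> * (u ^ 8 * v))) = chi (a * (\<omega> * (u * v ^ 8)))"
    proof -
      have "(a * (\<omega> * (u ^ 8 * v))) ^ q = a * (\<omega> * ((u ^ 8) ^ q * v ^ q))"
        by (simp add: power_mult_distrib a \<omega>_q)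
      also have "(u ^ 8) ^ q = v ^ 8" by (simp add: v_def mult.commute flip: power_mult)
      finally show ?thesis by (metis chi_power(1) vq mult.commute)
    qed
    have c3: "chi (\<beta> * (c * (\<omega> * (u\<^sup>2 * v)))) = chi (\<beta> ^ q * (c * (\<omega> * (u * v\<^sup>2))))"
    proof -
      have "(\<beta> * (c * (\<omega> * (u\<^sup>2 * v)))) ^ q = \<beta> ^ q * (c * (\<omega> * ((u\<^sup>2) ^ q * v ^ q)))"
        by (simp add: power_mult_distrib c \<omega>_q)
      also have "(u\<^sup>2) ^ q = v\<^sup>2" by (simp add: v_def mult.commute flip: power_mult)
      finally show ?thesis by (metis chi_power(1) vq mult.commute)
    qed
    have "chi (a * y ^ 9) = chi (a * (u * v ^ 8))"
    proof -
      have "chi (a * y ^ 9) = (chi (a * u ^ 9) * chi (a * u ^ 9)) *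
          (chi (a * (\<omega> * (u * v ^ 8))) * chi (a * (\<omega> * (u * v ^ 8)))) * chi (a * (u * v ^ 8))"
        unfolding y9 distrib_left distrib_right chi_add c1 c2 by (simp only: mult_1 mult_ac)
      then show ?thesis by simp
    qed
    moreover have "chi (\<beta> * (c * (y * cnorm y))) =
        chi (c * (\<omega>\<^sup>2 * \<beta> + \<omega> * \<beta> ^ q) * (u * v\<^sup>2))"
      unfolding yn distrib_left chi_add c3 unfolding \<omega>_sq distrib_left distrib_right chi_add
      by (simp only: mult_1 mult_ac)
    ultimately show ?thesis unfolding quad_def chi_add v_def by simp
  qed
  then show ?thesis
    unfolding quad_sum_def by (subst sum.reindex_bij_betw[OF bij_change, symmetric]) simp
qed

lemma three_walsh_sum:
  assumes "\<alpha> \<in> K"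
  shows "3 * walsh_sum \<alpha> \<beta> = (\<Sum>c\<in>reps. quad_sum (\<alpha> * c ^ 3) (c * (\<omega>\<^sup>2 * \<beta> + \<omega> * \<beta> ^ q)))"
proof -
  have "3 * walsh_sum \<alpha> \<beta> = (\<Sum>c\<in>reps. \<Sum>y\<in>UNIV. chi (\<alpha> * (c * y ^ 3) ^ 3 + \<beta> * sig (c * y ^ 3)))"
    unfolding walsh_sum_def by (rule sum_cube_cover[symmetric])
  also have "\<dots> = (\<Sum>c\<in>reps. \<Sum>y\<in>UNIV. chi (\<alpha> * c ^ 3 * y ^ 9 + \<beta> * (c * (y * cnorm y))))"
  proof (intro sum.cong refl)
    fix c y assume c: "c \<in> reps"
    have "(c * y ^ 3) ^ 3 = c ^ 3 * y ^ 9" by (simp add: power_mult_distrib flip: power_mult)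
    then show "chi (\<alpha> * (c * y ^ 3) ^ 3 + \<beta> * sig (c * y ^ 3)) =
        chi (\<alpha> * c ^ 3 * y ^ 9 + \<beta> * (c * (y * cnorm y)))"
      by (simp add: sig_scale[OF reps_K[OF c]] sig_cube mult.assoc)
  qed
  also have "\<dots> = (\<Sum>c\<in>reps. quad_sum (\<alpha> * c ^ 3) (c * (\<omega>\<^sup>2 * \<beta> + \<omega> * \<beta> ^ q)))"
  proof (rule sum.cong)
    fix c assume "c \<in> reps"
    then have "(\<alpha> * c ^ 3) ^ q = \<alpha> * c ^ 3" "c ^ q = c"
      using assms reps_K K_closed K_power K_iff by metis+
    then show "(\<Sum>y\<in>UNIV. chi (\<alpha> * c ^ 3 * y ^ 9 + \<beta> * (c * (y * cnorm y)))) =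
        quad_sum (\<alpha> * c ^ 3) (c * (\<omega>\<^sup>2 * \<beta> + \<omega> * \<beta> ^ q))"
      by (rule cubic_sum_eq_quad_sum)
  qed simp
  finally show ?thesis .
qed

end

section \<open>Moments of the Walsh transform\<close>

context quadratic_extension_noncube
begin

text \<open>An odd number of the three \<open>t c\<close> is odd, so their sum is odd. It is
  divisible by 3 because \<open>q\<close> is not, so the Walsh value is a nonzero multiple of
  \<open>q\<close>.\<close>

lemma walsh_sum_noncube:
  assumes \<alpha>: "\<alpha> \<in> K" "\<alpha> \<noteq> 0" "\<alpha> ^ cubord \<noteq> 1"
  shows "\<bar>walsh_sum \<alpha> \<beta>\<bar> \<ge> int q"
proof -
  define b where "b = \<omega>\<^sup>2 * \<beta> + \<omega> * \<beta> ^ q"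
  let ?R = "\<lambda>c. radical (\<alpha> * c ^ 3) (c * b)"
  have aK: "\<alpha> * c ^ 3 \<in> K" "\<alpha> * c ^ 3 \<noteq> 0" if "c \<in> reps" for c
    using \<alpha> reps_K[OF that] reps_nonzero[OF that] K_closed K_power by auto
  have "\<exists>t. quad_sum (\<alpha> * c ^ 3) (c * b) = int q * t \<and> (odd t \<longleftrightarrow> ?R c = {0})" if "c \<in> reps" for c
    by (rule quad_sum_cases[OF aK[OF that], of "c * b"]) auto
  then obtain t where t: "\<And>c. c \<in> reps \<Longrightarrow> quad_sum (\<alpha> * c ^ 3) (c * b) = int q * t c"
    "\<And>c. c \<in> reps \<Longrightarrow> odd (t c) \<longleftrightarrow> ?R c = {0}" by metis
  have "3 * walsh_sum \<alpha> \<beta> = (\<Sum>c\<in>reps. int q * t c)"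
    unfolding three_walsh_sum[OF \<alpha>(1)] b_def[symmetric] by (rule sum.cong) (use t in auto)
  also have "\<dots> = int q * (t 1 + t g + t (g\<^sup>2))"
    by (simp only: sum_reps distrib_left)
  finally have 3: "3 * walsh_sum \<alpha> \<beta> = int q * (t 1 + t g + t (g\<^sup>2))" .
  have "odd (card {c \<in> reps. ?R c = {0}})"
    using even_nontrivial_radicals[OF \<alpha>(1,2)] \<alpha>(3) by blast
  moreover have "card {c \<in> reps. ?R c = {0}} = card {c \<in> reps. odd (t c)}"
    using t(2) by (metis (mono_tags, lifting) Collect_cong)
  ultimately have "odd (card {c \<in> reps. odd (t c)})" by simp
  then have odd: "odd (t 1 + t g + t (g\<^sup>2))"
    unfolding card_reps_filter
    by (cases "odd (t 1)"; cases "odd (t g)"; cases "odd (t (g\<^sup>2))"; simp)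
  have "3 dvd t 1 + t g + t (g\<^sup>2)"
  proof -
    have "3 dvd int q * (t 1 + t g + t (g\<^sup>2))" using 3 by (metis dvd_triv_left)
    moreover have "coprime 3 (int q)"
    proof -
      have "\<not> 3 dvd int q" using q_mod_3 by presburger
      then show ?thesis by (simp add: prime_imp_coprime)
    qed
    ultimately show ?thesis by (simp add: coprime_dvd_mult_right_iff)
  qed
  then obtain s where s: "t 1 + t g + t (g\<^sup>2) = 3 * s" by (rule dvdE)
  then have s0: "s \<noteq> 0" using odd by (metis even_zero mult_zero_right)
  have "walsh_sum \<alpha> \<beta> = int q * s" using 3 s by simp
  moreover have "int q * 1 \<le> int q * \<bar>s\<bar>" using s0 by (intro mult_left_mono) auto
  ultimately show ?thesis by (simp add: abs_mult)
qed

lemma walsh_sum_cube: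
  assumes \<alpha>: "\<alpha> \<in> K" "\<alpha> \<noteq> 0" "\<alpha> ^ cubord = 1"
  shows "walsh_sum \<alpha> \<beta> \<in> {- 2 * int q, 0, 2 * int q}"
proof -
  define b where "b = \<omega>\<^sup>2 * \<beta> + \<omega> * \<beta> ^ q"
  let ?R = "\<lambda>c. radical (\<alpha> * c ^ 3) (c * b)"
  have aK: "\<alpha> * c ^ 3 \<in> K" "\<alpha> * c ^ 3 \<noteq> 0" if "c \<in> reps" for c
    using \<alpha> reps_K[OF that] reps_nonzero[OF that] K_closed K_power by auto
  have "\<exists>t. quad_sum (\<alpha> * c ^ 3) (c * b) = int q * t \<and> t \<in> {1, - 2, 4, - 8} \<and> (t = 1 \<longleftrightarrow> ?R c = {0}) \<and>
      (?R c \<noteq> {0} \<longrightarrow> card (?R c) \<le> 4 \<longrightarrow> t = - 2)" if "c \<in> reps" for c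
    by (rule quad_sum_cases[OF aK[OF that], of "c * b"]) blast
  then obtain t where t: "\<And>c. c \<in> reps \<Longrightarrow> quad_sum (\<alpha> * c ^ 3) (c * b) = int q * t c"
    "\<And>c. c \<in> reps \<Longrightarrow> t c \<in> {1, - 2, 4, - 8}" "\<And>c. c \<in> reps \<Longrightarrow> t c = 1 \<longleftrightarrow> ?R c = {0}"
    "\<And>c. c \<in> reps \<Longrightarrow> ?R c \<noteq> {0} \<Longrightarrow> card (?R c) \<le> 4 \<Longrightarrow> t c = - 2" by metis
  have "3 * walsh_sum \<alpha> \<beta> = (\<Sum>c\<in>reps. int q * t c)"
    unfolding three_walsh_sum[OF \<alpha>(1)] b_def[symmetric] by (rule sum.cong) (use t in auto)
  also have "\<dots> = int q * (t 1 + t g + t (g\<^sup>2))"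
    by (simp only: sum_reps distrib_left)
  finally have 3: "3 * walsh_sum \<alpha> \<beta> = int q * (t 1 + t g + t (g\<^sup>2))" .
  have "even (card {c \<in> reps. ?R c = {0}})"
    using even_nontrivial_radicals[OF \<alpha>(1,2)] \<alpha>(3) by blast
  moreover have "card {c \<in> reps. ?R c = {0}} = card {c \<in> reps. t c = 1}"
    using t(3) by (metis (mono_tags, lifting) Collect_cong)
  ultimately have "even (card {c \<in> reps. t c = 1})" by simp
  then have ev: "even (of_bool (t 1 = 1) + of_bool (t g = 1) + of_bool (t (g\<^sup>2) = 1) :: nat)"
    unfolding card_reps_filter .
  have in_reps: "1 \<in> reps" "g \<in> reps" "g\<^sup>2 \<in> reps" by (auto simp: reps_def)
  have "t 1 + t g + t (g\<^sup>2) \<in> {- 6, 0, 6}"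
  \<comment> \<open>By parity either exactly two \<open>t c\<close> are 1, and the third is -2, 4 or
    -8, or none is. In the latter case all radicals are nontrivial, hence small, and every
    \<open>t c\<close> is -2.\<close>
  proof (cases "\<exists>c\<in>reps. t c = 1")
    case True
    then have "t 1 = 1 \<or> t g = 1 \<or> t (g\<^sup>2) = 1" by (auto simp: reps_def)
    from t(2)[OF in_reps(1)] t(2)[OF in_reps(2)] t(2)[OF in_reps(3)] this ev
    show ?thesis by (elim insertE emptyE) simp_all
  next
    case False
    then have nt: "?R c \<noteq> {0}" if "c \<in> reps" for c using t(3) that by blast
    have "t c = - 2" if "c \<in> reps" for c
      using t(4)[OF that nt[OF that]] card_radical_le_4[OF \<alpha>(2) nt that] by blast
    then show ?thesis using in_reps by simp
  qed
  then show ?thesis using 3 by auto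
qed

section \<open>First and second moments over the whole field and over \<open>K\<close>\<close>

lemma sig_eq_0_iff: "sig x = 0 \<longleftrightarrow> x = 0"
proof -
  have "sig 0 = 0" using sig_scale[of 0 0] K_closed(1) by simp
  then show ?thesis using bij_sig by (metis bij_is_inj injD)
qed

lemma sig_K_iff: "sig x \<in> K \<longleftrightarrow> x \<in> K"
proof
  assume "x \<in> K"
  then have "sig x = x + x + x" using K_iff by (simp add: sig_eq K_power_d)
  then show "sig x \<in> K" using \<open>x \<in> K\<close> by simp
next
  assume s: "sig x \<in> K"
  have "cnorm (sig x) \<in> K" by (simp add: K_iff cnorm_K)
  then have "sig x ^ 3 * inverse (cnorm (sig x)) \<in> K" by (intro K_closed(4,5) K_power s)
  then show "x \<in> K" using sig_left_inverse[of x] by (simp add: divide_inverse)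
qed

text \<open>All these sums are nonnegative and together give \<open>q\<^sup>2\<close>. Those for
  \<open>y\<close> in \<open>K\<close> already account for this total, so the others vanish.\<close>

lemma sum_chi_K: "(\<Sum>\<beta>\<in>K. chi (\<beta> * y)) = (if y \<in> K then int q else 0)"
proof -
  let ?A = "\<lambda>y. \<Sum>\<beta>\<in>K. chi (\<beta> * y)"
  have in_K: "?A y = int q" if "y \<in> K" for y
    using that K_closed(4) by (simp add: chi_K card_K)
  have nonneg: "?A y \<ge> 0" for y
  proof (cases "\<exists>b\<in>K. chi (b * y) = - 1")
    case True
    then obtain b where b: "b \<in> K" "chi (b * y) = - 1" by blast
    have "?A y = (\<Sum>\<beta>\<in>K. chi ((\<beta> + b) * y))"
      by (rule sum.reindex_bij_witness[of _ "\<lambda>\<beta>. \<beta> + b" "\<lambda>\<beta>. \<beta> + b"])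
        (use b K_closed in \<open>auto simp: add.assoc\<close>)
    also have "\<dots> = - ?A y" by (simp only: distrib_right chi_add b) (simp add: sum_negf)
    finally show ?thesis by simp
  next
    case False
    then have "chi (\<beta> * y) = 1" if "\<beta> \<in> K" for \<beta> using chi_cases that by blast
    then show ?thesis by simp
  qed
  have "(\<Sum>y\<in>UNIV. ?A y) = (\<Sum>\<beta>\<in>K. \<Sum>y\<in>UNIV. chi (\<beta> * y))" by (rule sum.swap)
  also have "\<dots> = int (q\<^sup>2)" using K_closed(1) by (simp add: sum_chi)
  also have "(\<Sum>y\<in>UNIV. ?A y) = (\<Sum>y\<in>K. ?A y) + (\<Sum>y\<in>UNIV - K. ?A y)"
    using sum.subset_diff[of K UNIV ?A] by (simp add: add.commute)
  also have "(\<Sum>y\<in>K. ?A y) = int (q\<^sup>2)"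
    by (simp add: in_K card_K power2_eq_square)
  finally have "(\<Sum>y\<in>UNIV - K. ?A y) = 0" by simp
  then have "?A y = 0" if "y \<notin> K" for y
    using that nonneg by (subst (asm) sum_nonneg_eq_0_iff) auto
  then show ?thesis using in_K by auto
qed

lemma sum_walsh_sum: "(\<Sum>\<beta>\<in>UNIV. walsh_sum \<alpha> \<beta>) = int (q\<^sup>2)"
proof -
  have "(\<Sum>\<beta>\<in>UNIV. walsh_sum \<alpha> \<beta>) = (\<Sum>x\<in>UNIV. \<Sum>\<beta>\<in>UNIV. chi (\<alpha> * x ^ 3) * chi (sig x * \<beta>))"
    unfolding walsh_sum_def chi_add by (subst sum.swap) (simp only: mult.commute)
  also have "\<dots> = (\<Sum>x\<in>UNIV. chi (\<alpha> * x ^ 3) * (if sig x = 0 then int (q\<^sup>2) else 0))"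
    by (simp only: sum_distrib_left[symmetric] sum_chi)
  also have "\<dots> = (\<Sum>x\<in>(UNIV::'a set). if x = 0 then int (q\<^sup>2) else 0)"
    by (intro sum.cong) (auto simp: sig_eq_0_iff)
  finally show ?thesis by simp
qed

lemma sum_walsh_sum_K:
  assumes "\<alpha> \<in> K"
  shows "(\<Sum>\<beta>\<in>K. walsh_sum \<alpha> \<beta>) = int (q\<^sup>2)"
proof -
  have "(\<Sum>\<beta>\<in>K. walsh_sum \<alpha> \<beta>) = (\<Sum>x\<in>UNIV. \<Sum>\<beta>\<in>K. chi (\<alpha> * x ^ 3) * chi (\<beta> * sig x))"
    unfolding walsh_sum_def chi_add by (rule sum.swap)
  also have "\<dots> = (\<Sum>x\<in>UNIV. chi (\<alpha> * x ^ 3) * (if x \<in> K then int q else 0))"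
    by (simp only: sum_distrib_left[symmetric] sum_chi_K sig_K_iff)
  also have "\<dots> = (\<Sum>x\<in>UNIV. if x \<in> K then int q else 0)"
    using assms K_closed K_power by (intro sum.cong) (auto simp: chi_K)
  also have "\<dots> = int (q\<^sup>2)"
    by (simp add: sum.If_cases card_K power2_eq_square)
  finally show ?thesis .
qed

text \<open>Parseval's identity; injectivity of \<open>sig\<close> leaves only the diagonal
  terms.\<close>

lemma sum_walsh_sum_sq: "(\<Sum>\<beta>\<in>UNIV. (walsh_sum \<alpha> \<beta>)\<^sup>2) = int q ^ 4"
proof -
  let ?s = "\<lambda>x. chi (\<alpha> * x ^ 3)"
  have "(\<Sum>\<beta>\<in>UNIV. (walsh_sum \<alpha> \<beta>)\<^sup>2) =
      (\<Sum>\<beta>\<in>UNIV. \<Sum>x\<in>UNIV. \<Sum>y\<in>UNIV. ?s x * ?s y * chi ((sig x + sig y) * \<beta>))"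
  proof (rule sum.cong)
    fix \<beta> :: 'a
    have "(walsh_sum \<alpha> \<beta>)\<^sup>2 = (\<Sum>x\<in>UNIV. \<Sum>y\<in>UNIV. chi (\<alpha> * x ^ 3 + \<beta> * sig x) * chi (\<alpha> * y ^ 3 + \<beta> * sig y))"
      by (simp only: walsh_sum_def power2_eq_square sum_product)
    also have "\<dots> = (\<Sum>x\<in>UNIV. \<Sum>y\<in>UNIV. ?s x * ?s y * chi ((sig x + sig y) * \<beta>))"
      by (simp only: chi_add distrib_right) (simp only: mult_ac)
    finally show "(walsh_sum \<alpha> \<beta>)\<^sup>2 = (\<Sum>x\<in>UNIV. \<Sum>y\<in>UNIV. ?s x * ?s y * chi ((sig x + sig y) * \<beta>))" .
  qed simp
  also have "\<dots> = (\<Sum>x\<in>UNIV. \<Sum>y\<in>UNIV. \<Sum>\<beta>\<in>UNIV. ?s x * ?s y * chi ((sig x + sig y) * \<beta>))"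
    by (subst sum.swap) (intro sum.cong refl sum.swap)
  also have "\<dots> = (\<Sum>x\<in>UNIV. \<Sum>y\<in>UNIV. ?s x * ?s y * (if sig x + sig y = 0 then int (q\<^sup>2) else 0))"
    by (simp only: sum_distrib_left[symmetric] sum_chi)
  also have "\<dots> = (\<Sum>x\<in>(UNIV::'a set). \<Sum>y\<in>UNIV. if y = x then int (q\<^sup>2) else 0)"
    using bij_sig by (intro sum.cong) (auto simp: add_eq_0_iff_eq dest: injD[OF bij_is_inj])
  also have "\<dots> = int q ^ 4"
    by (simp add: card_F power2_eq_square power4_eq_xxxx)
  finally show ?thesis .
qed

lemma sum_split_K: "(\<Sum>\<beta>\<in>UNIV - K. f \<beta>) = (\<Sum>\<beta>\<in>UNIV. f \<beta>) - (\<Sum>\<beta>\<in>K. f \<beta>)" for f :: "'a \<Rightarrow> int"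
  using sum.subset_diff[of K UNIV f] by simp

lemma card_not_K: "int (card (UNIV - K)) = int q * (int q - 1)"
  by (simp add: card_Diff_subset card_F card_K power2_eq_square algebra_simps of_nat_diff)

lemma sum_walsh_sum_not_K: "\<alpha> \<in> K \<Longrightarrow> (\<Sum>\<beta>\<in>UNIV - K. walsh_sum \<alpha> \<beta>) = 0"
  by (simp add: sum_split_K sum_walsh_sum sum_walsh_sum_K)

text \<open>The mean of the Walsh values over \<open>K\<close> is \<open>q\<close>, so by
  nonnegativity of the variance their squares add up to at least \<open>q ^ 3\<close> there.
  Parseval bounds the rest.\<close>

lemma walsh_sum_sq_not_K_le:
  assumes "\<alpha> \<in> K"
  shows "(\<Sum>\<beta>\<in>UNIV - K. (walsh_sum \<alpha> \<beta>)\<^sup>2) \<le> int (card (UNIV - K)) * (int q)\<^sup>2"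
proof -
  have "0 \<le> (\<Sum>\<beta>\<in>K. (walsh_sum \<alpha> \<beta> - int q)\<^sup>2)" by (intro sum_nonneg) simp
  also have "\<dots> = (\<Sum>\<beta>\<in>K. (walsh_sum \<alpha> \<beta>)\<^sup>2) - 2 * int q * (\<Sum>\<beta>\<in>K. walsh_sum \<alpha> \<beta>) + int q * (int q)\<^sup>2"
    by (simp add: power2_diff sum.distrib sum_subtractf sum_distrib_left card_K mult_ac)
  finally have "(int q) ^ 3 \<le> (\<Sum>\<beta>\<in>K. (walsh_sum \<alpha> \<beta>)\<^sup>2)"
    by (simp add: sum_walsh_sum_K[OF assms] power2_eq_square power3_eq_cube)
  then show ?thesis
    unfolding sum_split_K sum_walsh_sum_sq card_not_K
    by (simp add: power2_eq_square power3_eq_cube power4_eq_xxxx algebra_simps)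
qed

section \<open>The value sets outside \<open>K\<close>\<close>

lemma not_K_nonempty: "UNIV - K \<noteq> {}"
proof -
  have "int (card (UNIV - K)) > 0" unfolding card_not_K using q_ge_4 by simp
  then show ?thesis by (metis card.empty of_nat_0 less_irrefl)
qed

text \<open>Every square is at least \<open>q\<^sup>2\<close> while their mean outside
  \<open>K\<close> is at most \<open>q\<^sup>2\<close>, so all absolute values equal
  \<open>q\<close>. Both signs occur because the values add up to 0.\<close>

lemma walsh_sum_image_noncube:
  assumes \<alpha>: "\<alpha> \<in> K" "\<alpha> \<noteq> 0" "\<alpha> ^ cubord \<noteq> 1"
  shows "walsh_sum \<alpha> ` (UNIV - K) = {int q, - int q}"
proof -
  have ge: "(walsh_sum \<alpha> \<beta>)\<^sup>2 - (int q)\<^sup>2 \<ge> 0" for \<beta>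
    using walsh_sum_noncube[OF \<alpha>, of \<beta>] abs_le_square_iff[of "int q" "walsh_sum \<alpha> \<beta>"] by simp
  have "(\<Sum>\<beta>\<in>UNIV - K. (walsh_sum \<alpha> \<beta>)\<^sup>2 - (int q)\<^sup>2) \<le> 0"
    using walsh_sum_sq_not_K_le[OF \<alpha>(1)] by (simp add: sum_subtractf)
  moreover have "(\<Sum>\<beta>\<in>UNIV - K. (walsh_sum \<alpha> \<beta>)\<^sup>2 - (int q)\<^sup>2) \<ge> 0"
    by (intro sum_nonneg ge)
  ultimately have "(\<Sum>\<beta>\<in>UNIV - K. (walsh_sum \<alpha> \<beta>)\<^sup>2 - (int q)\<^sup>2) = 0" by simp
  then have "\<forall>\<beta>\<in>UNIV - K. (walsh_sum \<alpha> \<beta>)\<^sup>2 - (int q)\<^sup>2 = 0"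
    by (subst (asm) sum_nonneg_eq_0_iff) (use ge in auto)
  then have vals: "walsh_sum \<alpha> \<beta> = int q \<or> walsh_sum \<alpha> \<beta> = - int q" if "\<beta> \<in> UNIV - K" for \<beta>
    using that by (simp add: power2_eq_iff)
  have "\<exists>\<beta>\<in>UNIV - K. walsh_sum \<alpha> \<beta> = s * int q" if s: "s = 1 \<or> s = - 1" for s
  proof (rule ccontr)
    assume "\<not> ?thesis"
    then have "walsh_sum \<alpha> \<beta> = - s * int q" if "\<beta> \<in> UNIV - K" for \<beta> using vals[OF that] s that by auto
    then have "(\<Sum>\<beta>\<in>UNIV - K. walsh_sum \<alpha> \<beta>) = int (card (UNIV - K)) * (- s * int q)"
      by simp
    then show False using sum_walsh_sum_not_K[OF \<alpha>(1)] not_K_nonempty s q_ge_4 by auto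
  qed
  from this[of 1] this[of "- 1"]
  have "int q \<in> walsh_sum \<alpha> ` (UNIV - K)" "- int q \<in> walsh_sum \<alpha> ` (UNIV - K)"
    by (simp_all only: image_iff) (metis mult_1 mult_minus_left)+
  then show ?thesis using vals by blast
qed

lemma walsh_sum_image_cube:
  assumes \<alpha>: "\<alpha> \<in> K" "\<alpha> \<noteq> 0" "\<alpha> ^ cubord = 1"
  shows "e = 2 \<Longrightarrow> walsh_sum \<alpha> ` (UNIV - K) = {0}"
    and "e \<ge> 4 \<Longrightarrow> walsh_sum \<alpha> ` (UNIV - K) = {- 2 * int q, 0, 2 * int q}"
proof -
  note vals = walsh_sum_cube[OF \<alpha>]
  {
    assume "e = 2"
    then have q: "q = 4" by (simp add: q_eq)
    \<comment> \<open>For \<open>q = 4\<close> all nonzero elements of \<open>K\<close> have cube 1,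
      so scaling \<open>x\<close> by \<open>t\<close> fixes the cubic term.\<close>
    have scale: "walsh_sum \<alpha> t = walsh_sum \<alpha> 1" if t: "t \<in> K" "t \<noteq> 0" for t
    proof -
      have "t * t ^ 3 = t * 1" using t K_iff[of t] q by (simp flip: power_Suc)
      then have t3: "t ^ 3 = 1" using t by simp
      have "walsh_sum \<alpha> t = (\<Sum>x\<in>UNIV. chi (\<alpha> * (t * x) ^ 3 + 1 * sig (t * x)))"
        using t by (simp add: walsh_sum_def sig_scale power_mult_distrib t3)
      also have "\<dots> = walsh_sum \<alpha> 1" unfolding walsh_sum_def
        by (rule sum.reindex_bij_witness[of _ "\<lambda>y. y / t" "\<lambda>x. t * x"]) (use t in auto)
      finally show ?thesis .
    qed
    have split: "(\<Sum>\<beta>\<in>K. h (walsh_sum \<alpha> \<beta>)) = h (walsh_sum \<alpha> 0) + 3 * h (walsh_sum \<alpha> 1)" for h :: "int \<Rightarrow> int"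
    proof -
      have "(\<Sum>\<beta>\<in>K. h (walsh_sum \<alpha> \<beta>)) = h (walsh_sum \<alpha> 0) + (\<Sum>\<beta>\<in>K - {0}. h (walsh_sum \<alpha> \<beta>))"
        by (rule sum.remove) (use K_closed in auto)
      also have "(\<Sum>\<beta>\<in>K - {0}. h (walsh_sum \<alpha> \<beta>)) = (\<Sum>\<beta>\<in>K - {0}. h (walsh_sum \<alpha> 1))"
        by (rule sum.cong) (use scale in auto)
      also have "\<dots> = 3 * h (walsh_sum \<alpha> 1)" using K_closed(1) by (simp add: card_K q)
      finally show ?thesis .
    qed
    have "walsh_sum \<alpha> 0 + 3 * walsh_sum \<alpha> 1 = 16"
      using split[of "\<lambda>x. x"] sum_walsh_sum_K[OF \<alpha>(1)] q by simp
    \<comment> \<open>Among the values -8, 0, 8 this is the only solution, and the squares on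
      \<open>K\<close> then exhaust the second moment 256.\<close>
    then have "walsh_sum \<alpha> 0 = - 8" "walsh_sum \<alpha> 1 = 8"
      using vals[of 0] vals[of 1] q by auto
    then have "(\<Sum>\<beta>\<in>UNIV - K. (walsh_sum \<alpha> \<beta>)\<^sup>2) = 0"
      unfolding sum_split_K sum_walsh_sum_sq using split[of "\<lambda>x. x\<^sup>2"] q by simp
    then have "\<forall>\<beta>\<in>UNIV - K. (walsh_sum \<alpha> \<beta>)\<^sup>2 = 0"
      by (subst (asm) sum_nonneg_eq_0_iff) auto
    then show "walsh_sum \<alpha> ` (UNIV - K) = {0}" using not_K_nonempty by auto
  }
  {
    assume "e \<ge> 4"
    then have "(2::nat) ^ 4 \<le> q" unfolding q_eq by (intro power_increasing) auto
    then have q: "q \<ge> 16" by simp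
    have sq_le: "(walsh_sum \<alpha> \<beta>)\<^sup>2 \<le> 4 * (int q)\<^sup>2" for \<beta>
      using vals[of \<beta>] by (auto simp: power_mult_distrib)
    have zero: "\<exists>\<beta>\<in>UNIV - K. walsh_sum \<alpha> \<beta> = 0"
    proof (rule ccontr)
      assume "\<not> ?thesis"
      then have "(walsh_sum \<alpha> \<beta>)\<^sup>2 = 4 * (int q)\<^sup>2" if "\<beta> \<in> UNIV - K" for \<beta>
        using vals[of \<beta>] that by (auto simp: power_mult_distrib)
      then have "int (card (UNIV - K)) * (4 * (int q)\<^sup>2) \<le> int (card (UNIV - K)) * (int q)\<^sup>2"
        using walsh_sum_sq_not_K_le[OF \<alpha>(1)] by simp
      moreover have "int (card (UNIV - K)) * (int q)\<^sup>2 > 0"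
        using not_K_nonempty q by (simp add: card_gt_0_iff)
      ultimately show False by simp
    qed
    \<comment> \<open>Values on \<open>K\<close> alone contribute at most \<open>4 * q ^ 3\<close>
      to the second moment, which is less than \<open>q ^ 4\<close> once \<open>q\<close> exceeds
      4.\<close>
    have nonzero: "\<exists>\<beta>\<in>UNIV - K. walsh_sum \<alpha> \<beta> \<noteq> 0"
    proof (rule ccontr)
      assume "\<not> ?thesis"
      then have "(\<Sum>\<beta>\<in>UNIV - K. (walsh_sum \<alpha> \<beta>)\<^sup>2) = 0" by simp
      then have "int q ^ 4 = (\<Sum>\<beta>\<in>K. (walsh_sum \<alpha> \<beta>)\<^sup>2)"
        unfolding sum_split_K sum_walsh_sum_sq by simp
      also have "\<dots> \<le> (\<Sum>\<beta>\<in>K. 4 * (int q)\<^sup>2)" by (intro sum_mono sq_le)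
      also have "\<dots> = 4 * int q ^ 3"
        by (simp add: card_K power2_eq_square power3_eq_cube)
      also have "\<dots> < int q * int q ^ 3" using q by (intro mult_strict_right_mono) auto
      finally show False by (simp flip: power_Suc)
    qed
    have "\<exists>\<beta>\<in>UNIV - K. walsh_sum \<alpha> \<beta> = s * (2 * int q)" if s: "s = 1 \<or> s = - 1" for s
    proof (rule ccontr)
      assume no: "\<not> ?thesis"
      have ge: "- s * walsh_sum \<alpha> \<beta> \<ge> 0" if "\<beta> \<in> UNIV - K" for \<beta>
        using vals[of \<beta>] no s that by auto
      have "(\<Sum>\<beta>\<in>UNIV - K. - s * walsh_sum \<alpha> \<beta>) = 0"
        by (simp only: sum_distrib_left[symmetric] sum_walsh_sum_not_K[OF \<alpha>(1)] mult_zero_right)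
      then have "\<forall>\<beta>\<in>UNIV - K. - s * walsh_sum \<alpha> \<beta> = 0"
        by (subst (asm) sum_nonneg_eq_0_iff) (use ge in auto)
      then show False using nonzero s by auto
    qed
    from this[of 1] this[of "- 1"] zero
    have "2 * int q \<in> walsh_sum \<alpha> ` (UNIV - K)" "- 2 * int q \<in> walsh_sum \<alpha> ` (UNIV - K)"
      "0 \<in> walsh_sum \<alpha> ` (UNIV - K)"
      by (simp_all only: image_iff) (metis mult_1 mult_minus_left)+
    then show "walsh_sum \<alpha> ` (UNIV - K) = {- 2 * int q, 0, 2 * int q}"
      using vals by blast
  }
qed

end

theorem theorem1p3:
  fixes K :: "'a::finite_field set" and e q :: nat
  assumes "even e" and "e > 0" and "q = 2 ^ e"
    and "card (UNIV :: 'a set) = q\<^sup>2"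
    and "is_subfield K" and "card K = q"
  shows "bij (poly (sigma q :: 'a poly)) \<and>
    (\<forall>\<alpha>\<in>K - {0}.
       ((\<exists>\<gamma>\<in>K. \<alpha> = \<gamma> ^ 3) \<longrightarrow>
          (e = 2 \<longrightarrow> walsh (2 * e) (f_alpha e \<alpha>) ` (UNIV - K) = {0}) \<and>
          (e \<ge> 4 \<longrightarrow> walsh (2 * e) (f_alpha e \<alpha>) ` (UNIV - K) = {- 2 * int q, 0, 2 * int q})) \<and>
       (\<not> (\<exists>\<gamma>\<in>K. \<alpha> = \<gamma> ^ 3) \<longrightarrow>
          walsh (2 * e) (f_alpha e \<alpha>) ` (UNIV - K) = {int q, - int q}))"
proof -
  interpret quadratic_extension K e q
    using assms by unfold_locales
  obtain g where g: "g \<in> K" "g ^ cubord \<noteq> 1" "g \<noteq> 0" using ex_noncube by blast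
  interpret quadratic_extension_noncube K e q g
    using g by unfold_locales
  have walsh_eq_walsh_sum: "walsh (2 * e) (f_alpha e \<alpha>) = walsh_sum \<alpha>" for \<alpha>
    by (rule ext) (simp only: walsh_eq walsh_sum_def)
  show ?thesis
    using bij_sig walsh_sum_image_cube walsh_sum_image_noncube cube_iff unfolding walsh_eq_walsh_sum by simp
qed

end
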